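(* Let $B,B'$ be agents, $\mathcal R$ a set of reaction rules and $(L,R,\eta)\in\mathcal R$. Suppose that $B$ can be rewritten into $B'$ by $(L,R,\eta)$, and let $W\mapsto Z$ be the multi-set rewrite rule corresponding to $(L,R,\eta)$ (for the decomposition of $B$ used in this rewriting). Then the square formed by the encoding $[\![\cdot]\!]$ and the two rewritings commutes: applying $W\mapsto Z$ to $[\![B]\!]$ in one step yields $[\![B']\!]$, i.e. there is a multi-set $\Delta$ with $[\![B]\!]=W\uplus\Delta$ and $[\![B']\!]=Z\uplus\Delta$.
   Context: **Bigraphs.** A signature is $\Sigma=(K,arity)$ with $K$ a set of controls and $arity:K\to\mathbb N$. A bigraph under $\Sigma$ is $B=(V_B,E_B,P_B,ctrl_B,prnt_B,link_B):\langle m,X\rangle\to\langle n,Y\rangle$, where $m,n$ are finite ordinals (the sites, resp. roots), $X,Y,V_B,E_B$ are finite sets (inner names, outer names, nodes, edges), $ctrl_B:V_B\to K$, $P_B=\{(v,i)\mid v\in V_B,\ i\in arity(ctrl_B\,v)\}$ (ports), $prnt_B:V_B\cup m\to V_B\cup n$ is total and establishes a tree-shaped (acyclic) parent ordering on the nodes, and $link_B:X\cup P_B\to E_B\cup Y$ is total. The sets $m,n,X,Y,V_B,E_B$ are assumed disjoint. $\langle m,X\rangle$ and $\langle n,Y\rangle$ are the inner and outer interfaces; $\epsilon=\langle 0,\emptyset\rangle$. A bigraph is ground if its inner interface is $\epsilon$; a ground bigraph is also called an agent. All bigraphs are over the same signature. **Composition.** For $F:\langle k,X\rangle\to\langle m,Y\rangle$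 and $G:\langle m,Y\rangle\to\langle n,Z\rangle$ with disjoint nodes and edges, $G\circ F:\langle k,X\rangle\to\langle n,Z\rangle$ has $V=V_G\uplus V_F$, $E=E_G\uplus E_F$, $ctrl=ctrl_G\uplus ctrl_F$; $prnt\,x=prnt_F\,x$ if $x\in k\uplus V_F$ and $prnt_F\,x\in V_F$, $prnt\,x=prnt_G\,j$ if $x\in k\uplus V_F$ and $prnt_F\,x=j\in m$, $prnt\,x=prnt_G\,x$ if $x\in V_G$; $link\,x=link_F\,x$ if $x\in X\uplus P_F$ and $link_F\,x\in E_F$, $link\,x=link_G\,y$ if $x\in X\uplus P_F$ and $link_F\,x=y\in Y$, $link\,x=link_G\,x$ if $x\in P_G$. **Juxtaposition.** For $F:\langle k,X\rangle\to\langle m,Y\rangle$ and $G:\langle l,W\rangle\to\langle n,Z\rangle$ with disjoint nodes, edges and names, $G\otimes F:\langle k+l,X\uplus W\rangle\to\langle m+n,Y\uplus Z\rangle$ has as components the disjoint unions of those of $F$ and $G$, with the sites and roots of $G$ shifted by $k$ and $m$ respectively. $d\Vert d'$ is $d\otimes d'$ where $d,d'$ may share edges and outer names. **Lean equivalence.** $B\bumpeq G$, for bigraphs with the same interfaces $\langle k,X\rangle\to\langle m,Y\rangle$, if there are bijections $\rho_V:V_B\to V_G$, $\rho_E:E_B\to E_G$ with $ctrl_G\circ\rho_V=ctrl_B$, $prnt_G\circ(Id_k\uplus\rho_V)=(Id_m\uplus\rho_V)\circ prnt_B$, $link_G\circ(Id_X\uplus\rho_P)=(Id_Y\uplus\rho_E)\circ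 link_B$, where $\rho_P(v,i)=(\rho_V v,i)$. **Reaction rules.** A ground reaction rule is a pair $(L,R)$ of ground bigraphs $L,R:\epsilon\to J$ with the same interfaces; it is regarded as a triple with $\eta$ empty. It rewrites $B\equiv C\circ L$ into $B'\equiv C\circ R$. A parametric reaction rule is a triple $(L:\langle m,X\rangle\to J,\ R:\langle m',X\rangle\to J,\ \eta:m'\to m)$ with $\eta$ a total function and the link graph inner interfaces of $L,R$ empty ($X=\emptyset$). For $F\equiv G\circ(d_0\otimes\dots\otimes d_{m-1})$ with $G$ a link graph (no nodes, identity on places) and each $d_i$ without inner names and with exactly one root, the instantiation is $\overline\eta\,F=G\circ(d'_0\Vert\dots\Vert d'_{m'-1})$ with $d'_j\bumpeq d_{\eta\,j}$ for all $j\in m'$. A parametric rule rewrites $B\equiv C\circ(D\otimes L)\circ C'$ into $B'\equiv C\circ(D\otimes R)\circ(\overline\eta\,C')$. Here $\equiv$ expresses decomposition of the bigraph (equality up to the choice of names for nodes and edges). **Relation symbols and encoding.** Facts are built from names of the disjoint sorts node, root, site, port, o_name, i_name, e_name, and from controls and natural numbers; $|t|$ denotes the element (e.g. the ordinal) that a name $t$ stands for. The facts are is_root $r$, is_node $a$, is_site $s$, is_port $p$, is_o_name $o$, is_i_name $i$, is_e_name $e$, prnt $x\,y$, link $x\,y$, lc $a\,k$, lp $p\,a$, has_child_p $y\,N$, has_child_l $y\,N$ (constructors injecting the sorts into sources and destinations are suppressed). Names are chosen injectively for the components of $B$; the same component has the same name in all encodings considered. $[\![B]\!]$ is the multi-set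 containing exactly once: is_root $r$, has_child_p $r$ $|prnt_B^{-1}(r)|$ for each root $r$; is_node $v$, lc $v$ $(ctrl_B\,v)$, has_child_p $v$ $|prnt_B^{-1}(v)|$, prnt $v$ $(prnt_B\,v)$ for each node $v$; is_site $s$, prnt $s$ $(prnt_B\,s)$ for each site $s$; is_port $p$, lp $p\,v$, link $p$ $(link_B\,p)$ for each port $p=(v,i)$; is_o_name $o$, has_child_l $o$ $|link_B^{-1}(o)|$ for each outer name $o$; is_e_name $e$, has_child_l $e$ $|link_B^{-1}(e)|$ for each edge $e$; is_i_name $x$, link $x$ $(link_B\,x)$ for each inner name $x$. **Partition.** For a bigraph $C$, $[\![C]\!]$ is partitioned as $\widetilde C\uplus out_C\uplus in_C$, where $out_C$ contains only the references to roots (is_root), outer names (is_o_name), prnt facts on roots and link facts on outer names; $in_C$ contains only the references to sites (is_site), inner names (is_i_name), prnt facts on sites and link facts on inner names; and $\widetilde C=[\![C]\!]\setminus out_C\setminus in_C$. For a composite $C\circ C'$, $eq_{CC'}$ is $$\{\text{prnt }x\,y\mid \text{is\_root }r\in[\![C']\!],\ \text{is\_site }s\in[\![C]\!],\ |s|=|r|,\ \text{prnt }x\,r\in[\![C']\!],\ \text{prnt }s\,y\in[\![C]\!]\}$$ $$\cup\ \{\text{link }x\,y\mid \text{is\_i\_name }i\in[\![C]\!],\ \text{is\_o\_name }o\in[\![C']\!],\ |i|=|o|,\ \text{link }i\,y\in[\![C]\!],\ \text{link }x\,o\in[\![C']\!]\}.$$ **Corresponding rewrite rule $W\mapsto Z$.**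 For a ground rule $(L,R)$ and context $C$: $W=\widetilde L\cup eq_{CL}$, $Z=\widetilde R\cup eq_{CR}$. For a parametric rule and decomposition $C,D,C'$: $W=eq_{C((D\otimes L)\circ C')}\cup\widetilde L\cup\widetilde D\cup eq_{DC'}\cup eq_{LC'}\cup\widetilde{C'}$ and $Z=eq_{C((D\otimes R)\circ(\overline\eta C'))}\cup\widetilde R\cup\widetilde D\cup eq_{D(\overline\eta C')}\cup eq_{R(\overline\eta C')}\cup\widetilde{(\overline\eta C')}$.
   Formalization: The corresponding rule is corrected: has_child facts on roots/outer names go to out; those counting sites/inner names go to in, with updated counts added to eq; eq between D or L (or R) and C' or its instance omits facts on roots/outer names; instantiation keeps idle outer names. *)

theory Defs
  imports "HOL-Library.Multiset"
begin

text \<open>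
  The constructors below keep sites, roots, inner names, outer names, nodes and edges apart, so no
  disjointness assumption on the underlying sets is needed. They are used both for the components
  of a bigraph (sites and roots being ordinals) and for their names in facts.
\<close>

datatype ('a, 's) place = Node 'a | Site 's
datatype ('a, 'r) parent = PNode 'a | PRoot 'r
datatype ('p, 'i) point = Port 'p | Inner 'i
datatype ('e, 'o) target = Edge 'e | Outer 'o

record 'k signature =
  controls :: "'k set"
  arity :: "'k \<Rightarrow> nat"

text \<open>
  Inner interface \<open>\<langle>sites, inn\<rangle>\<close>, outer interface \<open>\<langle>roots, outn\<rangle>\<close>. The maps are only meaningful on
  the domains used in \<open>bigraph\<close> below.
\<close>

record ('v, 'e, 'n, 'k) bigraph =
  sites :: nat
  inn :: "'n set"
  roots :: nat
  outn :: "'n set"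
  nodes :: "'v set"
  edges :: "'e set"
  ctrl :: "'v \<Rightarrow> 'k"
  prnt :: "('v, nat) place \<Rightarrow> ('v, nat) parent"
  link :: "('v \<times> nat, 'n) point \<Rightarrow> ('e, 'n) target"

definition ports :: "'k signature \<Rightarrow> ('v, 'e, 'n, 'k) bigraph \<Rightarrow> ('v \<times> nat) set" where
  "ports \<Sigma> B = {(v, i). v \<in> nodes B \<and> i < arity \<Sigma> (ctrl B v)}"

definition places :: "('v, 'e, 'n, 'k) bigraph \<Rightarrow> ('v, nat) place set" where
  "places B = Node ` nodes B \<union> Site ` {..<sites B}"

definition parents :: "('v, 'e, 'n, 'k) bigraph \<Rightarrow> ('v, nat) parent set" where
  "parents B = PNode ` nodes B \<union> PRoot ` {..<roots B}"

definition points :: "'k signature \<Rightarrow> ('v, 'e, 'n, 'k) bigraph \<Rightarrow> ('v \<times> nat, 'n) point set" where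
  "points \<Sigma> B = Port ` ports \<Sigma> B \<union> Inner ` inn B"

definition targets :: "('v, 'e, 'n, 'k) bigraph \<Rightarrow> ('e, 'n) target set" where
  "targets B = Edge ` edges B \<union> Outer ` outn B"

definition bigraph :: "'k signature \<Rightarrow> ('v, 'e, 'n, 'k) bigraph \<Rightarrow> bool" where
  "bigraph \<Sigma> B \<longleftrightarrow>
     finite (nodes B) \<and> finite (edges B) \<and> finite (inn B) \<and> finite (outn B) \<and>
     ctrl B ` nodes B \<subseteq> controls \<Sigma> \<and>
     prnt B ` places B \<subseteq> parents B \<and>
     acyclic {(v, w). v \<in> nodes B \<and> prnt B (Node v) = PNode w} \<and>
     link B ` points \<Sigma> B \<subseteq> targets B"

definition ground :: "('v, 'e, 'n, 'k) bigraph \<Rightarrow> bool" where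
  "ground B \<longleftrightarrow> sites B = 0 \<and> inn B = {}"

definition agent :: "'k signature \<Rightarrow> ('v, 'e, 'n, 'k) bigraph \<Rightarrow> bool" where
  "agent \<Sigma> B \<longleftrightarrow> bigraph \<Sigma> B \<and> ground B"

definition same_outer :: "('v, 'e, 'n, 'k) bigraph \<Rightarrow> ('v, 'e, 'n, 'k) bigraph \<Rightarrow> bool" where
  "same_outer B G \<longleftrightarrow> roots B = roots G \<and> outn B = outn G"

definition same_inner :: "('v, 'e, 'n, 'k) bigraph \<Rightarrow> ('v, 'e, 'n, 'k) bigraph \<Rightarrow> bool" where
  "same_inner B G \<longleftrightarrow> sites B = sites G \<and> inn B = inn G"

definition composable :: "('v, 'e, 'n, 'k) bigraph \<Rightarrow> ('v, 'e, 'n, 'k) bigraph \<Rightarrow> bool" where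
  "composable G F \<longleftrightarrow> sites G = roots F \<and> inn G = outn F \<and>
     nodes G \<inter> nodes F = {} \<and> edges G \<inter> edges F = {}"

definition comp :: "('v, 'e, 'n, 'k) bigraph \<Rightarrow> ('v, 'e, 'n, 'k) bigraph \<Rightarrow> ('v, 'e, 'n, 'k) bigraph" where
  "comp G F =
    (let up = (\<lambda>x. case prnt F x of PNode v \<Rightarrow> PNode v | PRoot j \<Rightarrow> prnt G (Site j));
         out = (\<lambda>x. case link F x of Edge e \<Rightarrow> Edge e | Outer y \<Rightarrow> link G (Inner y))
     in \<lparr> sites = sites F, inn = inn F, roots = roots G, outn = outn G,
          nodes = nodes G \<union> nodes F, edges = edges G \<union> edges F,
          ctrl = (\<lambda>v. if v \<in> nodes F then ctrl F v else ctrl G v),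
          prnt = (\<lambda>x. case x of
             Node v \<Rightarrow> if v \<in> nodes F then up x else prnt G x
           | Site i \<Rightarrow> up x),
          link = (\<lambda>x. case x of
             Port (v, i) \<Rightarrow> if v \<in> nodes F then out x else link G x
           | Inner y \<Rightarrow> out x) \<rparr>)"

text \<open>\<open>juxt G F\<close> is \<open>G \<otimes> F\<close>; the sites and roots of the left factor are the shifted ones.\<close>

definition juxtaposable :: "('v, 'e, 'n, 'k) bigraph \<Rightarrow> ('v, 'e, 'n, 'k) bigraph \<Rightarrow> bool" where
  "juxtaposable G F \<longleftrightarrow> nodes G \<inter> nodes F = {} \<and> edges G \<inter> edges F = {} \<and>
     inn G \<inter> inn F = {} \<and> outn G \<inter> outn F = {}"

definition juxt :: "('v, 'e, 'n, 'k) bigraph \<Rightarrow> ('v, 'e, 'n, 'k) bigraph \<Rightarrow> ('v, 'e, 'n, 'k) bigraph" where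
  "juxt G F =
    (let shift = map_parent id (\<lambda>j. roots F + j)
     in \<lparr> sites = sites F + sites G, inn = inn F \<union> inn G,
          roots = roots F + roots G, outn = outn F \<union> outn G,
          nodes = nodes F \<union> nodes G, edges = edges F \<union> edges G,
          ctrl = (\<lambda>v. if v \<in> nodes F then ctrl F v else ctrl G v),
          prnt = (\<lambda>x. case x of
             Node v \<Rightarrow> if v \<in> nodes F then prnt F x else shift (prnt G x)
           | Site i \<Rightarrow> if i < sites F then prnt F x else shift (prnt G (Site (i - sites F)))),
          link = (\<lambda>x. case x of
             Port (v, i) \<Rightarrow> if v \<in> nodes F then link F x else link G x
           | Inner y \<Rightarrow> if y \<in> inn F then link F x else link G x) \<rparr>)"

text \<open>
  The parallel product \<open>\<parallel>\<close> is given by \<open>juxt\<close> as well; only its definedness condition is weaker: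
  edges and outer names may be shared.
\<close>

definition parallelable :: "('v, 'e, 'n, 'k) bigraph \<Rightarrow> ('v, 'e, 'n, 'k) bigraph \<Rightarrow> bool" where
  "parallelable G F \<longleftrightarrow> nodes G \<inter> nodes F = {} \<and> inn G \<inter> inn F = {}"

text \<open>The values of the maps of the empty bigraph are irrelevant.\<close>

definition empty_bigraph :: "('v, 'e, 'n, 'k) bigraph" where
  "empty_bigraph = \<lparr> sites = 0, inn = {}, roots = 0, outn = {}, nodes = {}, edges = {},
     ctrl = undefined, prnt = undefined, link = undefined \<rparr>"

text \<open>
  Iterated (parallel) juxtaposition. For factors with one root each, the factor \<open>ds ! i\<close> ends up
  under root \<open>i\<close>, as the reading of an instantiation map on sites presupposes.
\<close>

definition juxt_list :: "('v, 'e, 'n, 'k) bigraph list \<Rightarrow> ('v, 'e, 'n, 'k) bigraph" where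
  "juxt_list ds = foldl (\<lambda>F d. juxt d F) empty_bigraph ds"

definition lean_iso :: "'k signature \<Rightarrow> ('v \<Rightarrow> 'v) \<Rightarrow> ('e \<Rightarrow> 'e) \<Rightarrow>
    ('v, 'e, 'n, 'k) bigraph \<Rightarrow> ('v, 'e, 'n, 'k) bigraph \<Rightarrow> bool" where
  "lean_iso \<Sigma> \<rho>V \<rho>E B G \<longleftrightarrow>
     same_inner B G \<and> same_outer B G \<and>
     bij_betw \<rho>V (nodes B) (nodes G) \<and> bij_betw \<rho>E (edges B) (edges G) \<and>
     (\<forall>v\<in>nodes B. ctrl G (\<rho>V v) = ctrl B v) \<and>
     (\<forall>x\<in>places B. prnt G (map_place \<rho>V id x) = map_parent \<rho>V id (prnt B x)) \<and>
     (\<forall>x\<in>points \<Sigma> B. link G (map_point (apfst \<rho>V) id x) = map_target \<rho>E id (link B x))"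

definition lean_equiv :: "'k signature \<Rightarrow>
    ('v, 'e, 'n, 'k) bigraph \<Rightarrow> ('v, 'e, 'n, 'k) bigraph \<Rightarrow> bool" where
  "lean_equiv \<Sigma> B G \<longleftrightarrow> (\<exists>\<rho>V \<rho>E. lean_iso \<Sigma> \<rho>V \<rho>E B G)"

text \<open>
  Instantiation maps \<open>\<eta> : m' \<rightarrow> m\<close> are finite maps with domain \<open>m'\<close>, so that a ground rule is exactly
  one whose map is \<open>Map.empty\<close> and whose two sides are ground.
\<close>

type_synonym ('v, 'e, 'n, 'k) rule =
  "('v, 'e, 'n, 'k) bigraph \<times> ('v, 'e, 'n, 'k) bigraph \<times> (nat \<rightharpoonup> nat)"

definition ground_rule :: "'k signature \<Rightarrow> ('v, 'e, 'n, 'k) rule \<Rightarrow> bool" where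
  "ground_rule \<Sigma> = (\<lambda>(L, R, \<eta>). bigraph \<Sigma> L \<and> bigraph \<Sigma> R \<and> same_outer L R \<and>
     ground L \<and> ground R \<and> \<eta> = Map.empty)"

definition parametric_rule :: "'k signature \<Rightarrow> ('v, 'e, 'n, 'k) rule \<Rightarrow> bool" where
  "parametric_rule \<Sigma> = (\<lambda>(L, R, \<eta>). bigraph \<Sigma> L \<and> bigraph \<Sigma> R \<and> same_outer L R \<and>
     inn L = {} \<and> inn R = {} \<and> dom \<eta> = {..<sites R} \<and> ran \<eta> \<subseteq> {..<sites L})"

definition reaction_rule :: "'k signature \<Rightarrow> ('v, 'e, 'n, 'k) rule \<Rightarrow> bool" where
  "reaction_rule \<Sigma> r \<longleftrightarrow> ground_rule \<Sigma> r \<or> parametric_rule \<Sigma> r"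

definition link_graph :: "('v, 'e, 'n, 'k) bigraph \<Rightarrow> bool" where
  "link_graph G \<longleftrightarrow> nodes G = {} \<and> sites G = roots G \<and> (\<forall>i<sites G. prnt G (Site i) = PRoot i)"

text \<open>The link graph \<open>G\<close>, regarded as the identity on \<open>w\<close> places.\<close>

definition on_width :: "nat \<Rightarrow> ('v, 'e, 'n, 'k) bigraph \<Rightarrow> ('v, 'e, 'n, 'k) bigraph" where
  "on_width w G = G\<lparr> sites := w, roots := w,
     prnt := (\<lambda>x. case x of Node v \<Rightarrow> PNode v | Site i \<Rightarrow> PRoot i) \<rparr>"

text \<open>
  \<open>instantiation_of \<Sigma> \<eta> m m' F F'\<close>: the bigraph \<open>F'\<close> is an instantiation of \<open>F\<close> along
  \<open>\<eta> : m' \<rightarrow> m\<close>. This is a relation, since the copies \<open>ds' ! j\<close> are determined only up to lean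
  equivalence. If \<open>\<eta>\<close> discards factors, their outer names are kept as idle names, for otherwise the
  outer face of the product of the copies would not match the inner face of \<open>G\<close>.
\<close>

definition instantiation_of :: "'k signature \<Rightarrow> (nat \<rightharpoonup> nat) \<Rightarrow> nat \<Rightarrow> nat \<Rightarrow>
    ('v, 'e, 'n, 'k) bigraph \<Rightarrow> ('v, 'e, 'n, 'k) bigraph \<Rightarrow> bool" where
  "instantiation_of \<Sigma> \<eta> m m' F F' \<longleftrightarrow> (\<exists>G ds ds'.
     bigraph \<Sigma> G \<and> link_graph G \<and>
     length ds = m \<and> (\<forall>d\<in>set ds. bigraph \<Sigma> d \<and> inn d = {} \<and> roots d = 1) \<and>
     (\<forall>i<m. \<forall>j<i. juxtaposable (ds ! i) (ds ! j)) \<and>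
     composable G (juxt_list ds) \<and>
     lean_equiv \<Sigma> F (comp G (juxt_list ds)) \<and>
     length ds' = m' \<and> (\<forall>d\<in>set ds'. bigraph \<Sigma> d) \<and>
     (\<forall>j<m'. lean_equiv \<Sigma> (ds' ! j) (ds ! the (\<eta> j))) \<and>
     (\<forall>i<m'. \<forall>j<i. parallelable (ds' ! i) (ds' ! j)) \<and>
     (let P = (juxt_list ds')\<lparr> outn := inn G \<rparr>
      in composable (on_width m' G) P \<and> F' = comp (on_width m' G) P))"

text \<open>
  The decomposition used in a rewriting step: \<open>C\<close> for \<open>C \<circ> L\<close>, and \<open>C\<close>, \<open>D\<close>, \<open>C'\<close> together with the
  chosen instantiation \<open>F'\<close> of \<open>C'\<close> for \<open>C \<circ> (D \<otimes> L) \<circ> C'\<close>.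
\<close>

datatype ('v, 'e, 'n, 'k) decomposition =
    Ground_dec "('v, 'e, 'n, 'k) bigraph"
  | Param_dec "('v, 'e, 'n, 'k) bigraph" "('v, 'e, 'n, 'k) bigraph"
              "('v, 'e, 'n, 'k) bigraph" "('v, 'e, 'n, 'k) bigraph"

text \<open>
  \<open>redex_reactum \<Sigma> r \<delta> G G'\<close>: along the decomposition \<open>\<delta>\<close>, the rule \<open>r\<close> takes \<open>G\<close> to \<open>G'\<close>, before
  nodes and edges are renamed. In the parametric case the interfaces force \<open>D\<close> to have no sites,
  because \<open>C'\<close> has exactly as many roots as \<open>L\<close> has sites; the inner names are all those of \<open>D\<close>.
\<close>

fun redex_reactum :: "'k signature \<Rightarrow> ('v, 'e, 'n, 'k) rule \<Rightarrow> ('v, 'e, 'n, 'k) decomposition \<Rightarrow>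
    ('v, 'e, 'n, 'k) bigraph \<Rightarrow> ('v, 'e, 'n, 'k) bigraph \<Rightarrow> bool" where
  "redex_reactum \<Sigma> (L, R, \<eta>) (Ground_dec C) G G' \<longleftrightarrow>
     ground_rule \<Sigma> (L, R, \<eta>) \<and> bigraph \<Sigma> C \<and>
     composable C L \<and> composable C R \<and>
     G = comp C L \<and> G' = comp C R"
| "redex_reactum \<Sigma> (L, R, \<eta>) (Param_dec C D C' F') G G' \<longleftrightarrow>
     parametric_rule \<Sigma> (L, R, \<eta>) \<and> bigraph \<Sigma> C \<and> bigraph \<Sigma> D \<and> bigraph \<Sigma> C' \<and>
     instantiation_of \<Sigma> \<eta> (sites L) (sites R) C' F' \<and>
     juxtaposable D L \<and> composable (juxt D L) C' \<and> composable C (comp (juxt D L) C') \<and>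
     juxtaposable D R \<and> composable (juxt D R) F' \<and> composable C (comp (juxt D R) F') \<and>
     G = comp C (comp (juxt D L) C') \<and> G' = comp C (comp (juxt D R) F')"

text \<open>
  \<open>B \<equiv> G\<close> and \<open>B' \<equiv> G'\<close> are witnessed by explicit renamings, which identify the components of
  \<open>B\<close> and \<open>B'\<close> with those of the decompositions.
\<close>

definition can_rewrite :: "'k signature \<Rightarrow> ('v, 'e, 'n, 'k) rule \<Rightarrow> ('v, 'e, 'n, 'k) decomposition \<Rightarrow>
    ('v \<Rightarrow> 'v) \<times> ('e \<Rightarrow> 'e) \<Rightarrow> ('v, 'e, 'n, 'k) bigraph \<Rightarrow>
    ('v \<Rightarrow> 'v) \<times> ('e \<Rightarrow> 'e) \<Rightarrow> ('v, 'e, 'n, 'k) bigraph \<Rightarrow> bool" where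
  "can_rewrite \<Sigma> r \<delta> \<rho> B \<rho>' B' \<longleftrightarrow> (\<exists>G G'. redex_reactum \<Sigma> r \<delta> G G' \<and>
     lean_iso \<Sigma> (fst \<rho>) (snd \<rho>) B G \<and> lean_iso \<Sigma> (fst \<rho>') (snd \<rho>') B' G')"

text \<open>
  One type parameter per sort of names: \<open>'a\<close> nodes, \<open>'r\<close> roots, \<open>'s\<close> sites, \<open>'p\<close> ports,
  \<open>'o\<close> outer names, \<open>'i\<close> inner names, \<open>'d\<close> edge names.
\<close>

datatype ('a, 'r, 's, 'p, 'o, 'i, 'd, 'k) fact =
    Is_root 'r
  | Is_node 'a
  | Is_site 's
  | Is_port 'p
  | Is_o_name 'o
  | Is_i_name 'i
  | Is_e_name 'd
  | Prnt "('a, 's) place" "('a, 'r) parent"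
  | Link "('p, 'i) point" "('d, 'o) target"
  | Lc 'a 'k
  | Lp 'p 'a
  | Has_child_p "('a, 'r) parent" nat
  | Has_child_l "('d, 'o) target" nat

record ('v, 'e, 'n, 'a, 'r, 's, 'p, 'o, 'i, 'd) naming =
  node_name :: "'v \<Rightarrow> 'a"
  root_name :: "nat \<Rightarrow> 'r"
  site_name :: "nat \<Rightarrow> 's"
  port_name :: "'v \<times> nat \<Rightarrow> 'p"
  o_name :: "'n \<Rightarrow> 'o"
  i_name :: "'n \<Rightarrow> 'i"
  e_name :: "'e \<Rightarrow> 'd"

definition injective_naming :: "('v, 'e, 'n, 'a, 'r, 's, 'p, 'o, 'i, 'd) naming \<Rightarrow> bool" where
  "injective_naming N \<longleftrightarrow> inj (node_name N) \<and> inj (root_name N) \<and> inj (site_name N) \<and>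
     inj (port_name N) \<and> inj (o_name N) \<and> inj (i_name N) \<and> inj (e_name N)"

text \<open>
  If \<open>\<rho>\<close> identifies the components of \<open>B\<close> with those of \<open>G\<close>, and \<open>N\<close> names the latter, then
  \<open>via \<rho> N\<close> gives the components of \<open>B\<close> the same names.
\<close>

definition via :: "('v \<Rightarrow> 'v) \<times> ('e \<Rightarrow> 'e) \<Rightarrow> ('v, 'e, 'n, 'a, 'r, 's, 'p, 'o, 'i, 'd) naming \<Rightarrow>
    ('v, 'e, 'n, 'a, 'r, 's, 'p, 'o, 'i, 'd) naming" where
  "via \<rho> N = N\<lparr> node_name := node_name N \<circ> fst \<rho>, port_name := port_name N \<circ> apfst (fst \<rho>),
     e_name := e_name N \<circ> snd \<rho> \<rparr>"

definition facts :: "'k signature \<Rightarrow> ('v, 'e, 'n, 'a, 'r, 's, 'p, 'o, 'i, 'd) naming \<Rightarrow>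
    ('v, 'e, 'n, 'k) bigraph \<Rightarrow> ('a, 'r, 's, 'p, 'o, 'i, 'd, 'k) fact set" where
  "facts \<Sigma> N B =
    (let place = map_place (node_name N) (site_name N);
         parent = map_parent (node_name N) (root_name N);
         point = map_point (port_name N) (i_name N);
         target = map_target (e_name N) (o_name N);
         children = (\<lambda>y. card {x \<in> places B. prnt B x = y});
         linked = (\<lambda>y. card {x \<in> points \<Sigma> B. link B x = y})
     in (\<Union>r\<in>{..<roots B}. {Is_root (root_name N r),
           Has_child_p (PRoot (root_name N r)) (children (PRoot r))})
      \<union> (\<Union>v\<in>nodes B. {Is_node (node_name N v), Lc (node_name N v) (ctrl B v),
           Has_child_p (PNode (node_name N v)) (children (PNode v)),
           Prnt (Node (node_name N v)) (parent (prnt B (Node v)))})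
      \<union> (\<Union>s\<in>{..<sites B}. {Is_site (site_name N s),
           Prnt (Site (site_name N s)) (parent (prnt B (Site s)))})
      \<union> (\<Union>p\<in>ports \<Sigma> B. {Is_port (port_name N p), Lp (port_name N p) (node_name N (fst p)),
           Link (Port (port_name N p)) (target (link B (Port p)))})
      \<union> (\<Union>y\<in>outn B. {Is_o_name (o_name N y),
           Has_child_l (Outer (o_name N y)) (linked (Outer y))})
      \<union> (\<Union>e\<in>edges B. {Is_e_name (e_name N e),
           Has_child_l (Edge (e_name N e)) (linked (Edge e))})
      \<union> (\<Union>x\<in>inn B. {Is_i_name (i_name N x),
           Link (Inner (i_name N x)) (target (link B (Inner x)))}))"

definition enc :: "'k signature \<Rightarrow> ('v, 'e, 'n, 'a, 'r, 's, 'p, 'o, 'i, 'd) naming \<Rightarrow>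
    ('v, 'e, 'n, 'k) bigraph \<Rightarrow> ('a, 'r, 's, 'p, 'o, 'i, 'd, 'k) fact multiset" where
  "enc \<Sigma> N B = mset_set (facts \<Sigma> N B)"

fun on_outer :: "('a, 'r, 's, 'p, 'o, 'i, 'd, 'k) fact \<Rightarrow> bool" where
  "on_outer (Is_root r) = True"
| "on_outer (Is_o_name y) = True"
| "on_outer (Prnt x (PRoot r)) = True"
| "on_outer (Link x (Outer y)) = True"
| "on_outer (Has_child_p (PRoot r) n) = True"
| "on_outer (Has_child_l (Outer y) n) = True"
| "on_outer _ = False"

text \<open>
  A child count is invalidated by composition exactly if it counts a site or an inner name of the
  encoding \<open>M\<close>; such a count therefore belongs to the inner face, and the updated count is part of
  \<open>count_facts\<close> below.
\<close>

fun on_inner :: "('a, 'r, 's, 'p, 'o, 'i, 'd, 'k) fact multiset \<Rightarrow>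
    ('a, 'r, 's, 'p, 'o, 'i, 'd, 'k) fact \<Rightarrow> bool" where
  "on_inner M (Is_site s) = True"
| "on_inner M (Is_i_name x) = True"
| "on_inner M (Prnt (Site s) y) = True"
| "on_inner M (Link (Inner x) y) = True"
| "on_inner M (Has_child_p y n) = (\<exists>s. Prnt (Site s) y \<in># M)"
| "on_inner M (Has_child_l y n) = (\<exists>x. Link (Inner x) y \<in># M)"
| "on_inner M _ = False"

definition out_part :: "'k signature \<Rightarrow> ('v, 'e, 'n, 'a, 'r, 's, 'p, 'o, 'i, 'd) naming \<Rightarrow>
    ('v, 'e, 'n, 'k) bigraph \<Rightarrow> ('a, 'r, 's, 'p, 'o, 'i, 'd, 'k) fact multiset" where
  "out_part \<Sigma> N C = filter_mset on_outer (enc \<Sigma> N C)"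

definition in_part :: "'k signature \<Rightarrow> ('v, 'e, 'n, 'a, 'r, 's, 'p, 'o, 'i, 'd) naming \<Rightarrow>
    ('v, 'e, 'n, 'k) bigraph \<Rightarrow> ('a, 'r, 's, 'p, 'o, 'i, 'd, 'k) fact multiset" where
  "in_part \<Sigma> N C = filter_mset (on_inner (enc \<Sigma> N C)) (enc \<Sigma> N C)"

text \<open>
  A site below a root (an inner name linked to an outer name) gives a fact lying in both
  \<open>out_part\<close> and \<open>in_part\<close>.
\<close>

definition tilde :: "'k signature \<Rightarrow> ('v, 'e, 'n, 'a, 'r, 's, 'p, 'o, 'i, 'd) naming \<Rightarrow>
    ('v, 'e, 'n, 'k) bigraph \<Rightarrow> ('a, 'r, 's, 'p, 'o, 'i, 'd, 'k) fact multiset" where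
  "tilde \<Sigma> N C = enc \<Sigma> N C - out_part \<Sigma> N C - in_part \<Sigma> N C"

text \<open>\<open>inv (root_name N) r\<close> is the ordinal \<open>|r|\<close> that the name \<open>r\<close> stands for, and so on.\<close>

definition eq_facts :: "'k signature \<Rightarrow> ('v, 'e, 'n, 'a, 'r, 's, 'p, 'o, 'i, 'd) naming \<Rightarrow>
    ('v, 'e, 'n, 'k) bigraph \<Rightarrow> ('v, 'e, 'n, 'k) bigraph \<Rightarrow>
    ('a, 'r, 's, 'p, 'o, 'i, 'd, 'k) fact set" where
  "eq_facts \<Sigma> N C C' =
     {Prnt x y | x y r s.
        Is_root r \<in># enc \<Sigma> N C' \<and> Is_site s \<in># enc \<Sigma> N C \<and>
        inv (site_name N) s = inv (root_name N) r \<and>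
        Prnt x (PRoot r) \<in># enc \<Sigma> N C' \<and> Prnt (Site s) y \<in># enc \<Sigma> N C} \<union>
     {Link x y | x y i u.
        Is_i_name i \<in># enc \<Sigma> N C \<and> Is_o_name u \<in># enc \<Sigma> N C' \<and>
        inv (i_name N) i = inv (o_name N) u \<and>
        Link (Inner i) y \<in># enc \<Sigma> N C \<and> Link x (Outer u) \<in># enc \<Sigma> N C'}"

text \<open>
  Plugging \<open>C'\<close> into \<open>C\<close> also changes the child counts of the places and links of \<open>C\<close> carrying a
  site or an inner name. Their new values count the remaining \<open>Prnt\<close> and \<open>Link\<close> facts of \<open>C\<close>
  together with those in \<open>eq_facts\<close>.
\<close>

definition count_facts :: "'k signature \<Rightarrow> ('v, 'e, 'n, 'a, 'r, 's, 'p, 'o, 'i, 'd) naming \<Rightarrow>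
    ('v, 'e, 'n, 'k) bigraph \<Rightarrow> ('v, 'e, 'n, 'k) bigraph \<Rightarrow>
    ('a, 'r, 's, 'p, 'o, 'i, 'd, 'k) fact set" where
  "count_facts \<Sigma> N C C' =
    (let M = set_mset (enc \<Sigma> N C - in_part \<Sigma> N C) \<union> eq_facts \<Sigma> N C C'
     in {Has_child_p y (card {x. Prnt x y \<in> M}) | y. \<exists>s. Prnt (Site s) y \<in># enc \<Sigma> N C} \<union>
        {Has_child_l y (card {x. Link x y \<in> M}) | y. \<exists>i. Link (Inner i) y \<in># enc \<Sigma> N C})"

definition eq_part :: "'k signature \<Rightarrow> ('v, 'e, 'n, 'a, 'r, 's, 'p, 'o, 'i, 'd) naming \<Rightarrow>
    ('v, 'e, 'n, 'k) bigraph \<Rightarrow> ('v, 'e, 'n, 'k) bigraph \<Rightarrow>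
    ('a, 'r, 's, 'p, 'o, 'i, 'd, 'k) fact multiset" where
  "eq_part \<Sigma> N C C' = mset_set (eq_facts \<Sigma> N C C' \<union> count_facts \<Sigma> N C C')"

text \<open>
  For a bigraph \<open>C\<close> that is itself plugged into a context, the roots and outer names of \<open>C\<close>
  vanish; the facts of \<open>eq_part\<close> about them are superseded by those obtained from the context.
\<close>

definition inner_eq_part :: "'k signature \<Rightarrow> ('v, 'e, 'n, 'a, 'r, 's, 'p, 'o, 'i, 'd) naming \<Rightarrow>
    ('v, 'e, 'n, 'k) bigraph \<Rightarrow> ('v, 'e, 'n, 'k) bigraph \<Rightarrow>
    ('a, 'r, 's, 'p, 'o, 'i, 'd, 'k) fact multiset" where
  "inner_eq_part \<Sigma> N C C' = filter_mset (\<lambda>f. \<not> on_outer f) (eq_part \<Sigma> N C C')"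

definition ground_side :: "'k signature \<Rightarrow> ('v, 'e, 'n, 'a, 'r, 's, 'p, 'o, 'i, 'd) naming \<Rightarrow>
    ('v, 'e, 'n, 'k) bigraph \<Rightarrow> ('v, 'e, 'n, 'k) bigraph \<Rightarrow>
    ('a, 'r, 's, 'p, 'o, 'i, 'd, 'k) fact multiset" where
  "ground_side \<Sigma> N C L = tilde \<Sigma> N L \<union># eq_part \<Sigma> N C L"

definition parametric_side :: "'k signature \<Rightarrow> ('v, 'e, 'n, 'a, 'r, 's, 'p, 'o, 'i, 'd) naming \<Rightarrow>
    ('v, 'e, 'n, 'k) bigraph \<Rightarrow> ('v, 'e, 'n, 'k) bigraph \<Rightarrow>
    ('v, 'e, 'n, 'k) bigraph \<Rightarrow> ('v, 'e, 'n, 'k) bigraph \<Rightarrow>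
    ('a, 'r, 's, 'p, 'o, 'i, 'd, 'k) fact multiset" where
  "parametric_side \<Sigma> N C D L C' =
     eq_part \<Sigma> N C (comp (juxt D L) C') \<union># tilde \<Sigma> N L \<union># tilde \<Sigma> N D \<union>#
     inner_eq_part \<Sigma> N D C' \<union># inner_eq_part \<Sigma> N L C' \<union># tilde \<Sigma> N C'"

fun corresponding_rule :: "'k signature \<Rightarrow> ('v, 'e, 'n, 'a, 'r, 's, 'p, 'o, 'i, 'd) naming \<Rightarrow>
    ('v, 'e, 'n, 'k) rule \<Rightarrow> ('v, 'e, 'n, 'k) decomposition \<Rightarrow>
    ('a, 'r, 's, 'p, 'o, 'i, 'd, 'k) fact multiset \<times> ('a, 'r, 's, 'p, 'o, 'i, 'd, 'k) fact multiset" where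
  "corresponding_rule \<Sigma> N (L, R, \<eta>) (Ground_dec C) =
     (ground_side \<Sigma> N C L, ground_side \<Sigma> N C R)"
| "corresponding_rule \<Sigma> N (L, R, \<eta>) (Param_dec C D C' F') =
     (parametric_side \<Sigma> N C D L C', parametric_side \<Sigma> N C D R F')"

end

theory Submission
  imports Defs
begin

text \<open>
  Plugging a ground \<open>F\<close> into \<open>C\<close> splits the facts of \<open>C \<circ> F\<close> into two disjoint parts. Those of \<open>C\<close>
  that mention no site or inner name, and count none, survive unchanged and do not depend on \<open>F\<close>;
  all others come from the interior of \<open>F\<close> or from the glueing of \<open>F\<close> to \<open>C\<close>, and these are exactly
  the facts in one side of a ground rule. So the surviving facts of the context form \<open>\<Delta>\<close>.

  In the parametric case the interfaces force \<open>D\<close> to have no sites, and \<open>L\<close>, \<open>R\<close> have no inner names.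
  Hence the interior of \<open>(D \<otimes> L) \<circ> C'\<close> is the union of the interiors of \<open>D\<close>, \<open>L\<close>, \<open>C'\<close> and the
  glueings of \<open>C'\<close> to \<open>D\<close> and to \<open>L\<close>, so that a side of the parametric rule for \<open>C\<close>, \<open>D\<close>, \<open>C'\<close> is the
  side of a ground rule for the context \<open>C\<close>. Of the instantiation, only well-formedness matters.
\<close>

section \<open>Well-formed composites and instantiations\<close>

text \<open>Finiteness and totality of the two maps are what the fact sets and child counts rest on.
  This fragment of \<open>bigraph\<close> passes through composition and through products sharing
  edges, and so reaches the instantiated parameter \<open>F'\<close>, which comes with no
  \<open>bigraph\<close> assumption.\<close>

definition well_formed :: "'k signature \<Rightarrow> ('v, 'e, 'n, 'k) bigraph \<Rightarrow> bool" where
  "well_formed \<Sigma> B \<longleftrightarrow>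
     finite (nodes B) \<and> finite (edges B) \<and> finite (inn B) \<and> finite (outn B) \<and>
     prnt B ` places B \<subseteq> parents B \<and> link B ` points \<Sigma> B \<subseteq> targets B"

lemma bigraph_well_formed: "bigraph \<Sigma> B \<Longrightarrow> well_formed \<Sigma> B"
  by (simp add: bigraph_def well_formed_def)

lemma well_formed_prnt: "well_formed \<Sigma> B \<Longrightarrow> x \<in> places B \<Longrightarrow> prnt B x \<in> parents B"
  by (auto simp: well_formed_def)

lemma well_formed_link: "well_formed \<Sigma> B \<Longrightarrow> x \<in> points \<Sigma> B \<Longrightarrow> link B x \<in> targets B"
  by (auto simp: well_formed_def)

lemma mem_components [simp]:
  "Node v \<in> places B \<longleftrightarrow> v \<in> nodes B"
  "Site i \<in> places B \<longleftrightarrow> i < sites B"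
  "PNode v \<in> parents B \<longleftrightarrow> v \<in> nodes B"
  "PRoot j \<in> parents B \<longleftrightarrow> j < roots B"
  "Port p \<in> points \<Sigma> B \<longleftrightarrow> p \<in> ports \<Sigma> B"
  "Inner x \<in> points \<Sigma> B \<longleftrightarrow> x \<in> inn B"
  "Edge e \<in> targets B \<longleftrightarrow> e \<in> edges B"
  "Outer y \<in> targets B \<longleftrightarrow> y \<in> outn B"
  by (auto simp: places_def parents_def points_def targets_def)

lemma mem_ports [simp]: "(v, i) \<in> ports \<Sigma> B \<longleftrightarrow> v \<in> nodes B \<and> i < arity \<Sigma> (ctrl B v)"
  by (simp add: ports_def)

lemma finite_ports: "finite (nodes B) \<Longrightarrow> finite (ports \<Sigma> B)"
proof -
  assume "finite (nodes B)"
  moreover have "ports \<Sigma> B = (SIGMA v:nodes B. {..<arity \<Sigma> (ctrl B v)})"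
    by (auto simp: ports_def)
  ultimately show ?thesis by simp
qed

section \<open>Components and maps of composites and juxtapositions\<close>

lemma comp_simps [simp]:
  "sites (comp G F) = sites F" "inn (comp G F) = inn F"
  "roots (comp G F) = roots G" "outn (comp G F) = outn G"
  "nodes (comp G F) = nodes G \<union> nodes F" "edges (comp G F) = edges G \<union> edges F"
  "ctrl (comp G F) v = (if v \<in> nodes F then ctrl F v else ctrl G v)"
  by (simp_all add: comp_def Let_def)

lemma juxt_simps [simp]:
  "sites (juxt G F) = sites F + sites G" "inn (juxt G F) = inn F \<union> inn G"
  "roots (juxt G F) = roots F + roots G" "outn (juxt G F) = outn F \<union> outn G"
  "nodes (juxt G F) = nodes F \<union> nodes G" "edges (juxt G F) = edges F \<union> edges G"
  "ctrl (juxt G F) v = (if v \<in> nodes F then ctrl F v else ctrl G v)"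
  by (simp_all add: juxt_def Let_def)

text \<open>This and \<open>plug_target\<close> name the local functions \<open>up\<close> and
  \<open>out\<close> of \<open>comp\<close>, taken as functions of the parent or target reached
  inside the inner bigraph.\<close>

definition plug_parent :: "('v, 'e, 'n, 'k) bigraph \<Rightarrow> ('v, nat) parent \<Rightarrow> ('v, nat) parent" where
  "plug_parent G y = (case y of PNode v \<Rightarrow> PNode v | PRoot j \<Rightarrow> prnt G (Site j))"

definition plug_target :: "('v, 'e, 'n, 'k) bigraph \<Rightarrow> ('e, 'n) target \<Rightarrow> ('e, 'n) target" where
  "plug_target G y = (case y of Edge e \<Rightarrow> Edge e | Outer x \<Rightarrow> link G (Inner x))"

lemma plug_simps [simp]:
  "plug_parent G (PNode v) = PNode v" "plug_parent G (PRoot j) = prnt G (Site j)"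
  "plug_target G (Edge e) = Edge e" "plug_target G (Outer x) = link G (Inner x)"
  by (simp_all add: plug_parent_def plug_target_def)

text \<open>\<open>fst p\<close> replaces the pair pattern of the definition, so that the equations
  also rewrite a port variable.\<close>

lemma comp_maps [simp]:
  "prnt (comp G F) (Node v) =
     (if v \<in> nodes F then plug_parent G (prnt F (Node v)) else prnt G (Node v))"
  "prnt (comp G F) (Site i) = plug_parent G (prnt F (Site i))"
  "link (comp G F) (Port p) =
     (if fst p \<in> nodes F then plug_target G (link F (Port p)) else link G (Port p))"
  "link (comp G F) (Inner x) = plug_target G (link F (Inner x))"
  by (cases p; simp add: comp_def Let_def plug_parent_def plug_target_def)+

lemma juxt_maps [simp]:
  "prnt (juxt G F) (Node v) = (if v \<in> nodes F then prnt F (Node v)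
     else map_parent id (\<lambda>j. roots F + j) (prnt G (Node v)))"
  "prnt (juxt G F) (Site i) = (if i < sites F then prnt F (Site i)
     else map_parent id (\<lambda>j. roots F + j) (prnt G (Site (i - sites F))))"
  "link (juxt G F) (Port p) = (if fst p \<in> nodes F then link F (Port p) else link G (Port p))"
  "link (juxt G F) (Inner x) = (if x \<in> inn F then link F (Inner x) else link G (Inner x))"
  by (cases p; simp add: juxt_def Let_def)+

text \<open>The controls of the composite prefer \<open>F\<close>, so on a shared node the arity
  could change; disjoint nodes exclude this.\<close>

lemma ports_comp: "nodes G \<inter> nodes F = {} \<Longrightarrow> ports \<Sigma> (comp G F) = ports \<Sigma> G \<union> ports \<Sigma> F"
  by (auto simp: ports_def disjoint_iff)

lemma ports_juxt: "nodes G \<inter> nodes F = {} \<Longrightarrow> ports \<Sigma> (juxt G F) = ports \<Sigma> G \<union> ports \<Sigma> F"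
  by (auto simp: ports_def disjoint_iff)

lemma ball_places: "(\<forall>x\<in>places B. P x) \<longleftrightarrow> (\<forall>v\<in>nodes B. P (Node v)) \<and> (\<forall>i<sites B. P (Site i))"
  by (auto simp: places_def)

lemma ball_points:
  "(\<forall>x\<in>points \<Sigma> B. P x) \<longleftrightarrow> (\<forall>p\<in>ports \<Sigma> B. P (Port p)) \<and> (\<forall>y\<in>inn B. P (Inner y))"
  by (auto simp: points_def)

lemma bex_places: "(\<exists>x\<in>places B. P x) \<longleftrightarrow> (\<exists>v\<in>nodes B. P (Node v)) \<or> (\<exists>i<sites B. P (Site i))"
  by (auto simp: places_def)

lemma bex_points:
  "(\<exists>x\<in>points \<Sigma> B. P x) \<longleftrightarrow> (\<exists>p\<in>ports \<Sigma> B. P (Port p)) \<or> (\<exists>y\<in>inn B. P (Inner y))"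
  by (auto simp: points_def)

text \<open>Matching interfaces make every root of \<open>F\<close> a site of \<open>G\<close> and
  every outer name of \<open>F\<close> an inner name of \<open>G\<close>, so redirection through
  \<open>G\<close> stays where the maps of \<open>G\<close> are total.\<close>

lemma well_formed_comp:
  assumes G: "well_formed \<Sigma> G" and F: "well_formed \<Sigma> F" and GF: "composable G F"
  shows "well_formed \<Sigma> (comp G F)"
proof -
  have pG: "prnt G x \<in> parents (comp G F)" if "x \<in> places G" for x
    using well_formed_prnt[OF G that] by (auto simp: parents_def)
  have lG: "link G x \<in> targets (comp G F)" if "x \<in> points \<Sigma> G" for x
    using well_formed_link[OF G that] by (auto simp: targets_def)
  have up: "plug_parent G y \<in> parents (comp G F)" if "y \<in> parents F" for y
    using that GF pG[of "Site j" for j] by (cases y) (simp_all add: composable_def)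
  have out: "plug_target G y \<in> targets (comp G F)" if "y \<in> targets F" for y
    using that GF lG[of "Inner x" for x] by (cases y) (simp_all add: composable_def)
  have "\<forall>x\<in>places (comp G F). prnt (comp G F) x \<in> parents (comp G F)"
    using well_formed_prnt[OF F] by (auto simp: ball_places intro!: up pG)
  moreover have "\<forall>x\<in>points \<Sigma> (comp G F). link (comp G F) x \<in> targets (comp G F)"
    using well_formed_link[OF F] GF
    by (auto simp: ball_points intro!: out lG simp: ports_comp composable_def)
  ultimately show ?thesis
    using G F by (auto simp: well_formed_def)
qed

text \<open>Disjointness is asked of the nodes only, so that the parallel product, where edges and
  outer names may be shared, is covered as well.\<close>

lemma well_formed_juxt:
  assumes G: "well_formed \<Sigma> G" and F: "well_formed \<Sigma> F" and GF: "nodes G \<inter> nodes F = {}"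
  shows "well_formed \<Sigma> (juxt G F)"
proof -
  have pG: "map_parent id (\<lambda>j. roots F + j) (prnt G x) \<in> parents (juxt G F)" if "x \<in> places G" for x
    using well_formed_prnt[OF G that] by (cases "prnt G x") auto
  have pF: "prnt F x \<in> parents (juxt G F)" if "x \<in> places F" for x
    using well_formed_prnt[OF F that] by (auto simp: parents_def)
  have lG: "link G x \<in> targets (juxt G F)" if "x \<in> points \<Sigma> G" for x
    using well_formed_link[OF G that] by (auto simp: targets_def)
  have lF: "link F x \<in> targets (juxt G F)" if "x \<in> points \<Sigma> F" for x
    using well_formed_link[OF F that] by (auto simp: targets_def)
  have "\<forall>x\<in>places (juxt G F). prnt (juxt G F) x \<in> parents (juxt G F)"
    by (auto simp: ball_places intro!: pG pF)
  moreover have "\<forall>x\<in>points \<Sigma> (juxt G F). link (juxt G F) x \<in> targets (juxt G F)"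
    using GF by (auto simp: ball_points ports_juxt intro!: lG lF)
  ultimately show ?thesis
    using G F by (auto simp: well_formed_def)
qed

section \<open>Iterated juxtaposition and instantiations\<close>

lemma juxt_list_Nil: "juxt_list [] = empty_bigraph"
  by (simp add: juxt_list_def)

lemma juxt_list_snoc: "juxt_list (ds @ [d]) = juxt d (juxt_list ds)"
  by (simp add: juxt_list_def)

lemma juxt_list_components [simp]:
  "roots (juxt_list ds) = sum_list (map roots ds)"
  "outn (juxt_list ds) = (\<Union>d\<in>set ds. outn d)"
  "nodes (juxt_list ds) = (\<Union>d\<in>set ds. nodes d)"
  by (induction ds rule: rev_induct)
     (auto simp: juxt_list_Nil juxt_list_snoc empty_bigraph_def)

text \<open>Induction from the right follows the left fold in \<open>juxt_list\<close>: the last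
  factor is the left factor of the outermost \<open>juxt\<close>.\<close>

lemma well_formed_juxt_list:
  "\<forall>d\<in>set ds. well_formed \<Sigma> d \<Longrightarrow> \<forall>i<length ds. \<forall>j<i. nodes (ds ! i) \<inter> nodes (ds ! j) = {} \<Longrightarrow>
     well_formed \<Sigma> (juxt_list ds)"
proof (induction ds rule: rev_induct)
  case Nil
  show ?case
    by (simp add: juxt_list_Nil empty_bigraph_def well_formed_def places_def points_def ports_def)
next
  case (snoc d ds)
  \<comment> \<open>Index \<open>length ds\<close> addresses the new factor \<open>d\<close>,
    smaller indices the old ones; hence the bound \<open>\<le>\<close>.\<close>
  have *: "nodes ((ds @ [d]) ! i) \<inter> nodes ((ds @ [d]) ! j) = {}" if "i \<le> length ds" "j < i" for i j
    using snoc.prems(2) that by simp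
  have "nodes (ds ! i) \<inter> nodes (ds ! j) = {}" if "i < length ds" "j < i" for i j
    using *[of i j] that by (simp add: nth_append)
  then have "well_formed \<Sigma> (juxt_list ds)"
    using snoc.IH snoc.prems(1) by simp
  moreover have "nodes d \<inter> nodes (ds ! j) = {}" if "j < length ds" for j
    using *[of "length ds" j] that by (simp add: nth_append)
  then have "nodes d \<inter> nodes e = {}" if "e \<in> set ds" for e
    using that unfolding in_set_conv_nth by blast
  then have "nodes d \<inter> nodes (juxt_list ds) = {}"
    by (simp add: Int_UN_distrib)
  ultimately show ?case
    using snoc.prems(1) well_formed_juxt[of \<Sigma> d "juxt_list ds"] by (simp add: juxt_list_snoc)
qed

text \<open>Enlarging the outer face adds only idle names; this is how an instantiation keeps the
  names of discarded factors.\<close>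

lemma well_formed_outn_update:
  assumes "well_formed \<Sigma> B" "outn B \<subseteq> Y" "finite Y"
  shows "well_formed \<Sigma> (B\<lparr> outn := Y \<rparr>)"
proof -
  have "places (B\<lparr> outn := Y \<rparr>) = places B" "parents (B\<lparr> outn := Y \<rparr>) = parents B"
      "points \<Sigma> (B\<lparr> outn := Y \<rparr>) = points \<Sigma> B" "targets B \<subseteq> targets (B\<lparr> outn := Y \<rparr>)"
    using assms(2) by (auto simp: places_def parents_def points_def ports_def targets_def)
  then show ?thesis
    using assms(1,3) unfolding well_formed_def by auto
qed

text \<open>Without nodes the only places are sites, and the new parent map sends each to the root
  of the same index; the link side is untouched.\<close>

lemma well_formed_on_width:
  assumes "well_formed \<Sigma> G" "nodes G = {}"
  shows "well_formed \<Sigma> (on_width w G)"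
proof -
  have "points \<Sigma> (on_width w G) = points \<Sigma> G" "targets (on_width w G) = targets G"
      "link (on_width w G) = link G"
    by (auto simp: points_def ports_def targets_def on_width_def)
  moreover have "prnt (on_width w G) ` places (on_width w G) \<subseteq> parents (on_width w G)"
    using assms(2) by (auto simp: places_def on_width_def)
  ultimately show ?thesis
    using assms by (simp add: well_formed_def) (simp add: on_width_def)
qed

lemma lean_equiv_outer: "lean_equiv \<Sigma> B G \<Longrightarrow> roots B = roots G \<and> outn B = outn G"
  by (auto simp: lean_equiv_def lean_iso_def same_outer_def)

text \<open>Each parameter has one root, so their product has \<open>m\<close>, and the link graph
  above it has as many roots as sites. This later forces \<open>D\<close> to have no sites.\<close>

lemma instantiation_roots:
  assumes "instantiation_of \<Sigma> \<eta> m m' F F'"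
  shows "roots F = m"
proof -
  obtain G ds where "link_graph G" "length ds = m" "\<forall>d\<in>set ds. roots d = 1"
      "composable G (juxt_list ds)" "lean_equiv \<Sigma> F (comp G (juxt_list ds))"
    using assms by (auto simp: instantiation_of_def)
  moreover from this have "map roots ds = replicate m 1"
    by (auto intro: replicate_eqI)
  ultimately show ?thesis
    by (auto simp: link_graph_def composable_def lean_equiv_def lean_iso_def same_outer_def
        sum_list_replicate)
qed

text \<open>The product of the node-disjoint copies is well-formed; the point is that replacing its
  outer face by \<open>inn G\<close> loses no name.\<close>

lemma instantiation_well_formed:
  assumes inst: "instantiation_of \<Sigma> \<eta> m m' F F'" and \<eta>: "dom \<eta> = {..<m'}" "ran \<eta> \<subseteq> {..<m}"
  shows "well_formed \<Sigma> F'"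
proof -
  obtain G ds ds' where
    G: "bigraph \<Sigma> G" "link_graph G" and
    ds: "length ds = m" and
    cmp: "composable G (juxt_list ds)" and
    ds': "length ds' = m'" "\<forall>d\<in>set ds'. bigraph \<Sigma> d" and
    eqv: "\<forall>j<m'. lean_equiv \<Sigma> (ds' ! j) (ds ! the (\<eta> j))" and
    par: "\<forall>i<m'. \<forall>j<i. parallelable (ds' ! i) (ds' ! j)" and
    cmp': "composable (on_width m' G) ((juxt_list ds')\<lparr> outn := inn G \<rparr>)" and
    F': "F' = comp (on_width m' G) ((juxt_list ds')\<lparr> outn := inn G \<rparr>)"
    using inst unfolding instantiation_of_def Let_def by blast
  have wfG: "well_formed \<Sigma> G"
    using G(1) by (rule bigraph_well_formed)
  have "outn d \<subseteq> inn G" if d: "d \<in> set ds'" for d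
  proof -
    obtain j where j: "j < m'" "d = ds' ! j"
      using d unfolding in_set_conv_nth ds'(1) by blast
    have "j \<in> dom \<eta>"
      using j(1) \<eta>(1) by simp
    then obtain i where i: "\<eta> j = Some i"
      by blast
    then have "i < m"
      using ranI[of \<eta> j i] \<eta>(2) by blast
    moreover have "outn d = outn (ds ! i)"
      using eqv[rule_format, OF j(1)] by (simp add: i j(2) lean_equiv_outer)
    ultimately have "outn d = outn (ds ! i)" "ds ! i \<in> set ds"
      using ds by simp_all
    then show ?thesis
      using cmp by (auto simp: composable_def)
  qed
  then have out: "outn (juxt_list ds') \<subseteq> inn G"
    by auto
  have "\<forall>d\<in>set ds'. well_formed \<Sigma> d"
    using ds'(2) bigraph_well_formed by blast
  moreover have "\<forall>i<length ds'. \<forall>j<i. nodes (ds' ! i) \<inter> nodes (ds' ! j) = {}"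
    using par ds'(1) by (simp add: parallelable_def)
  ultimately have "well_formed \<Sigma> (juxt_list ds')"
    by (rule well_formed_juxt_list)
  then have "well_formed \<Sigma> ((juxt_list ds')\<lparr> outn := inn G \<rparr>)"
    using out wfG by (intro well_formed_outn_update) (simp_all add: well_formed_def)
  moreover have "well_formed \<Sigma> (on_width m' G)"
    using wfG G(2) by (intro well_formed_on_width) (simp_all add: link_graph_def)
  ultimately show ?thesis
    using cmp' by (simp add: F' well_formed_comp)
qed

section \<open>Membership in the sets of facts\<close>

abbreviation place_name where "place_name N \<equiv> map_place (node_name N) (site_name N)"
abbreviation parent_name where "parent_name N \<equiv> map_parent (node_name N) (root_name N)"
abbreviation point_name where "point_name N \<equiv> map_point (port_name N) (i_name N)"
abbreviation target_name where "target_name N \<equiv> map_target (e_name N) (o_name N)"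

lemma bex_parents:
  "(\<exists>z\<in>parents B. P z) \<longleftrightarrow> (\<exists>v\<in>nodes B. P (PNode v)) \<or> (\<exists>j<roots B. P (PRoot j))"
  by (auto simp: parents_def)

lemma bex_targets:
  "(\<exists>t\<in>targets B. P t) \<longleftrightarrow> (\<exists>e\<in>edges B. P (Edge e)) \<or> (\<exists>y\<in>outn B. P (Outer y))"
  by (auto simp: targets_def)

text \<open>One equivalence per constructor, so that equality of fact sets can be shown by cases on
  the fact. Quantifying over \<open>places\<close>, \<open>parents\<close>, \<open>points\<close>
  and \<open>targets\<close> merges the clauses that \<open>facts\<close> lists separately for each
  sort.\<close>

lemma mem_facts [simp]:
  "Is_root r \<in> facts \<Sigma> N B \<longleftrightarrow> r \<in> root_name N ` {..<roots B}"
  "Is_node a \<in> facts \<Sigma> N B \<longleftrightarrow> a \<in> node_name N ` nodes B"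
  "Is_site s \<in> facts \<Sigma> N B \<longleftrightarrow> s \<in> site_name N ` {..<sites B}"
  "Is_port p \<in> facts \<Sigma> N B \<longleftrightarrow> p \<in> port_name N ` ports \<Sigma> B"
  "Is_o_name y \<in> facts \<Sigma> N B \<longleftrightarrow> y \<in> o_name N ` outn B"
  "Is_i_name c \<in> facts \<Sigma> N B \<longleftrightarrow> c \<in> i_name N ` inn B"
  "Is_e_name e \<in> facts \<Sigma> N B \<longleftrightarrow> e \<in> e_name N ` edges B"
  "Lc a k \<in> facts \<Sigma> N B \<longleftrightarrow> (\<exists>v\<in>nodes B. a = node_name N v \<and> k = ctrl B v)"
  "Lp p a \<in> facts \<Sigma> N B \<longleftrightarrow>
     (\<exists>q\<in>ports \<Sigma> B. p = port_name N q \<and> a = node_name N (fst q))"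
  "Prnt x z \<in> facts \<Sigma> N B \<longleftrightarrow>
     (\<exists>w\<in>places B. x = place_name N w \<and> z = parent_name N (prnt B w))"
  "Link u t \<in> facts \<Sigma> N B \<longleftrightarrow>
     (\<exists>w\<in>points \<Sigma> B. u = point_name N w \<and> t = target_name N (link B w))"
  "Has_child_p z n \<in> facts \<Sigma> N B \<longleftrightarrow>
     (\<exists>w\<in>parents B. z = parent_name N w \<and> n = card {x \<in> places B. prnt B x = w})"
  "Has_child_l t n \<in> facts \<Sigma> N B \<longleftrightarrow>
     (\<exists>w\<in>targets B. t = target_name N w \<and> n = card {x \<in> points \<Sigma> B. link B x = w})"
  by (auto simp: facts_def Let_def bex_places bex_points bex_parents bex_targets)

section \<open>Finiteness, and injectivity of names\<close>

lemma finite_components: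
  assumes "well_formed \<Sigma> B"
  shows "finite (places B)" "finite (parents B)" "finite (points \<Sigma> B)" "finite (targets B)"
  using assms
  by (simp_all add: well_formed_def places_def parents_def points_def targets_def finite_ports)

lemma finite_facts: "well_formed \<Sigma> B \<Longrightarrow> finite (facts \<Sigma> N B)"
  by (simp add: facts_def Let_def well_formed_def finite_ports)

lemma mem_enc [simp]: "well_formed \<Sigma> B \<Longrightarrow> f \<in># enc \<Sigma> N B \<longleftrightarrow> f \<in> facts \<Sigma> N B"
  by (simp add: enc_def finite_facts)

lemma injective_names:
  assumes "injective_naming N"
  shows "inj (node_name N)" "inj (root_name N)" "inj (site_name N)" "inj (port_name N)"
    "inj (o_name N)" "inj (i_name N)" "inj (e_name N)"
    "inj (place_name N)" "inj (parent_name N)" "inj (point_name N)" "inj (target_name N)"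
  using assms by (simp_all add: injective_naming_def place.inj_map parent.inj_map point.inj_map
      target.inj_map)

lemma naming_eq_simps:
  assumes "injective_naming N"
  shows "node_name N v = node_name N v' \<longleftrightarrow> v = v'" "root_name N r = root_name N r' \<longleftrightarrow> r = r'"
    "site_name N s = site_name N s' \<longleftrightarrow> s = s'" "port_name N p = port_name N p' \<longleftrightarrow> p = p'"
    "o_name N y = o_name N y' \<longleftrightarrow> y = y'" "i_name N x = i_name N x' \<longleftrightarrow> x = x'"
    "e_name N e = e_name N e' \<longleftrightarrow> e = e'" "place_name N w = place_name N w' \<longleftrightarrow> w = w'"
    "parent_name N z = parent_name N z' \<longleftrightarrow> z = z'" "point_name N u = point_name N u' \<longleftrightarrow> u = u'"
    "target_name N t = target_name N t' \<longleftrightarrow> t = t'"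
  using injective_names[OF assms] by (simp_all add: inj_eq)

text \<open>Naming preserves constructors, so the sort of a name reveals the sort of the
  component.\<close>

lemma name_shapes:
  "Node a = place_name N x \<longleftrightarrow> (\<exists>v. x = Node v \<and> a = node_name N v)"
  "Site s = place_name N x \<longleftrightarrow> (\<exists>i. x = Site i \<and> s = site_name N i)"
  "PNode a = parent_name N z \<longleftrightarrow> (\<exists>v. z = PNode v \<and> a = node_name N v)"
  "PRoot r = parent_name N z \<longleftrightarrow> (\<exists>j. z = PRoot j \<and> r = root_name N j)"
  "Port p = point_name N u \<longleftrightarrow> (\<exists>q. u = Port q \<and> p = port_name N q)"
  "Inner c = point_name N u \<longleftrightarrow> (\<exists>y. u = Inner y \<and> c = i_name N y)"
  "Edge d = target_name N t \<longleftrightarrow> (\<exists>e. t = Edge e \<and> d = e_name N e)"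
  "Outer o' = target_name N t \<longleftrightarrow> (\<exists>y. t = Outer y \<and> o' = o_name N y)"
  by (cases x; cases z; cases u; cases t; simp)+

lemma on_outer_names [simp]:
  "on_outer (Prnt x (parent_name N z)) \<longleftrightarrow> (\<forall>v. z \<noteq> PNode v)"
  "on_outer (Has_child_p (parent_name N z) n) \<longleftrightarrow> (\<forall>v. z \<noteq> PNode v)"
  "on_outer (Link u (target_name N t)) \<longleftrightarrow> (\<forall>e. t \<noteq> Edge e)"
  "on_outer (Has_child_l (target_name N t) n) \<longleftrightarrow> (\<forall>e. t \<noteq> Edge e)"
  by (cases z; cases t; simp)+

text \<open>The part of the encoding of a context that becomes \<open>\<Delta>\<close>.\<close>

definition frame_facts where
  "frame_facts \<Sigma> N C = {f \<in> facts \<Sigma> N C. \<not> on_inner (enc \<Sigma> N C) f}"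

text \<open>Set counterpart of \<open>tilde\<close>, as every fact of an encoding has multiplicity
  one.\<close>

definition core_facts where
  "core_facts \<Sigma> N C = {f \<in> facts \<Sigma> N C. \<not> on_outer f \<and> \<not> on_inner (enc \<Sigma> N C) f}"

text \<open>A fact may lie in both the outer and the inner part. All multiplicities are one and
  multiset difference truncates at zero, so subtracting such a fact twice is harmless.\<close>

lemma tilde_eq: "well_formed \<Sigma> C \<Longrightarrow> tilde \<Sigma> N C = mset_set (core_facts \<Sigma> N C)"
  by (rule multiset_eqI)
     (auto simp: tilde_def out_part_def in_part_def enc_def core_facts_def finite_facts
       count_mset_set')

text \<open>Dropping inner facts leaves only nodes and ports as sources of \<open>Prnt\<close> and
  \<open>Link\<close>, and only counts at targets that carry no site or inner name. For the counts,
  injectivity matters: \<open>on_inner\<close> compares names, not components.\<close>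

lemma mem_frame_facts:
  assumes wf: "well_formed \<Sigma> C" and N: "injective_naming N"
  shows
  "Is_root r \<in> frame_facts \<Sigma> N C \<longleftrightarrow> r \<in> root_name N ` {..<roots C}"
  "Is_node a \<in> frame_facts \<Sigma> N C \<longleftrightarrow> a \<in> node_name N ` nodes C"
  "Is_site s \<notin> frame_facts \<Sigma> N C"
  "Is_port p \<in> frame_facts \<Sigma> N C \<longleftrightarrow> p \<in> port_name N ` ports \<Sigma> C"
  "Is_o_name y \<in> frame_facts \<Sigma> N C \<longleftrightarrow> y \<in> o_name N ` outn C"
  "Is_i_name x \<notin> frame_facts \<Sigma> N C"
  "Is_e_name e \<in> frame_facts \<Sigma> N C \<longleftrightarrow> e \<in> e_name N ` edges C"
  "Lc a k \<in> frame_facts \<Sigma> N C \<longleftrightarrow> (\<exists>v\<in>nodes C. a = node_name N v \<and> k = ctrl C v)"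
  "Lp p a \<in> frame_facts \<Sigma> N C \<longleftrightarrow>
     (\<exists>q\<in>ports \<Sigma> C. p = port_name N q \<and> a = node_name N (fst q))"
  "Prnt w z \<in> frame_facts \<Sigma> N C \<longleftrightarrow>
     (\<exists>v\<in>nodes C. w = Node (node_name N v) \<and> z = parent_name N (prnt C (Node v)))"
  "Link u t \<in> frame_facts \<Sigma> N C \<longleftrightarrow>
     (\<exists>q\<in>ports \<Sigma> C. u = Port (port_name N q) \<and> t = target_name N (link C (Port q)))"
  "Has_child_p z n \<in> frame_facts \<Sigma> N C \<longleftrightarrow>
     (\<exists>b\<in>parents C. z = parent_name N b \<and> (\<forall>s<sites C. prnt C (Site s) \<noteq> b) \<and>
        n = card {x \<in> places C. prnt C x = b})"
  "Has_child_l t n \<in> frame_facts \<Sigma> N C \<longleftrightarrow>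
     (\<exists>b\<in>targets C. t = target_name N b \<and> (\<forall>x\<in>inn C. link C (Inner x) \<noteq> b) \<and>
        n = card {x \<in> points \<Sigma> C. link C x = b})"
proof -
  show "Prnt w z \<in> frame_facts \<Sigma> N C \<longleftrightarrow>
     (\<exists>v\<in>nodes C. w = Node (node_name N v) \<and> z = parent_name N (prnt C (Node v)))"
    by (cases w) (auto simp: frame_facts_def bex_places)
  show "Link u t \<in> frame_facts \<Sigma> N C \<longleftrightarrow>
     (\<exists>q\<in>ports \<Sigma> C. u = Port (port_name N q) \<and> t = target_name N (link C (Port q)))"
    by (cases u) (auto simp: frame_facts_def bex_points)
  show "Has_child_p z n \<in> frame_facts \<Sigma> N C \<longleftrightarrow>
     (\<exists>b\<in>parents C. z = parent_name N b \<and> (\<forall>s<sites C. prnt C (Site s) \<noteq> b) \<and>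
        n = card {x \<in> places C. prnt C x = b})"
    using wf by (auto simp: frame_facts_def name_shapes naming_eq_simps[OF N] bex_places)
  show "Has_child_l t n \<in> frame_facts \<Sigma> N C \<longleftrightarrow>
     (\<exists>b\<in>targets C. t = target_name N b \<and> (\<forall>x\<in>inn C. link C (Inner x) \<noteq> b) \<and>
        n = card {x \<in> points \<Sigma> C. link C x = b})"
    using wf by (auto simp: frame_facts_def name_shapes naming_eq_simps[OF N] bex_points)
qed (simp_all add: frame_facts_def)

lemma core_facts_eq: "core_facts \<Sigma> N C = {f \<in> frame_facts \<Sigma> N C. \<not> on_outer f}"
  by (auto simp: core_facts_def frame_facts_def)

text \<open>Excluding outer facts as well confines parents to nodes and targets to edges.\<close>

lemma mem_core_facts:
  assumes wf: "well_formed \<Sigma> C" and N: "injective_naming N"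
  shows
  "Is_root r \<notin> core_facts \<Sigma> N C"
  "Is_node a \<in> core_facts \<Sigma> N C \<longleftrightarrow> a \<in> node_name N ` nodes C"
  "Is_site s \<notin> core_facts \<Sigma> N C"
  "Is_port p \<in> core_facts \<Sigma> N C \<longleftrightarrow> p \<in> port_name N ` ports \<Sigma> C"
  "Is_o_name y \<notin> core_facts \<Sigma> N C"
  "Is_i_name x \<notin> core_facts \<Sigma> N C"
  "Is_e_name e \<in> core_facts \<Sigma> N C \<longleftrightarrow> e \<in> e_name N ` edges C"
  "Lc a k \<in> core_facts \<Sigma> N C \<longleftrightarrow> (\<exists>v\<in>nodes C. a = node_name N v \<and> k = ctrl C v)"
  "Lp p a \<in> core_facts \<Sigma> N C \<longleftrightarrow>
     (\<exists>q\<in>ports \<Sigma> C. p = port_name N q \<and> a = node_name N (fst q))"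
  "Prnt w z \<in> core_facts \<Sigma> N C \<longleftrightarrow>
     (\<exists>v\<in>nodes C. \<exists>v'. prnt C (Node v) = PNode v' \<and>
        w = Node (node_name N v) \<and> z = PNode (node_name N v'))"
  "Link u t \<in> core_facts \<Sigma> N C \<longleftrightarrow>
     (\<exists>q\<in>ports \<Sigma> C. \<exists>e'. link C (Port q) = Edge e' \<and>
        u = Port (port_name N q) \<and> t = Edge (e_name N e'))"
  "Has_child_p z n \<in> core_facts \<Sigma> N C \<longleftrightarrow>
     (\<exists>v\<in>nodes C. z = PNode (node_name N v) \<and> (\<forall>s<sites C. prnt C (Site s) \<noteq> PNode v) \<and>
        n = card {x \<in> places C. prnt C x = PNode v})"
  "Has_child_l t n \<in> core_facts \<Sigma> N C \<longleftrightarrow>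
     (\<exists>e'\<in>edges C. t = Edge (e_name N e') \<and> (\<forall>x\<in>inn C. link C (Inner x) \<noteq> Edge e') \<and>
        n = card {x \<in> points \<Sigma> C. link C x = Edge e'})"
proof -
  show "Prnt w z \<in> core_facts \<Sigma> N C \<longleftrightarrow>
     (\<exists>v\<in>nodes C. \<exists>v'. prnt C (Node v) = PNode v' \<and>
        w = Node (node_name N v) \<and> z = PNode (node_name N v'))"
    by (auto simp: core_facts_eq mem_frame_facts[OF wf N] name_shapes naming_eq_simps[OF N])
  show "Link u t \<in> core_facts \<Sigma> N C \<longleftrightarrow>
     (\<exists>q\<in>ports \<Sigma> C. \<exists>e'. link C (Port q) = Edge e' \<and>
        u = Port (port_name N q) \<and> t = Edge (e_name N e'))"
    by (auto simp: core_facts_eq mem_frame_facts[OF wf N] name_shapes naming_eq_simps[OF N])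
  show "Has_child_p z n \<in> core_facts \<Sigma> N C \<longleftrightarrow>
     (\<exists>v\<in>nodes C. z = PNode (node_name N v) \<and> (\<forall>s<sites C. prnt C (Site s) \<noteq> PNode v) \<and>
        n = card {x \<in> places C. prnt C x = PNode v})"
    by (auto simp: core_facts_eq mem_frame_facts[OF wf N] name_shapes naming_eq_simps[OF N])
  show "Has_child_l t n \<in> core_facts \<Sigma> N C \<longleftrightarrow>
     (\<exists>e'\<in>edges C. t = Edge (e_name N e') \<and> (\<forall>x\<in>inn C. link C (Inner x) \<noteq> Edge e') \<and>
        n = card {x \<in> points \<Sigma> C. link C x = Edge e'})"
    by (auto simp: core_facts_eq mem_frame_facts[OF wf N] name_shapes naming_eq_simps[OF N])
qed (simp_all add: core_facts_eq mem_frame_facts[OF wf N])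

text \<open>Injectivity lets \<open>inv\<close> recover ordinals and names, so the equality between
  site and root becomes one shared index \<open>j\<close>. Nothing here makes the interfaces match,
  so \<open>j\<close> is bounded by the sites of \<open>C\<close> explicitly; that it is a root of
  \<open>F\<close> follows from well-formedness.\<close>

lemma mem_eq_facts:
  assumes C: "well_formed \<Sigma> C" and F: "well_formed \<Sigma> F" and N: "injective_naming N"
  shows
  "Is_root r \<notin> eq_facts \<Sigma> N C F"
  "Is_node a \<notin> eq_facts \<Sigma> N C F"
  "Is_site s \<notin> eq_facts \<Sigma> N C F"
  "Is_port p \<notin> eq_facts \<Sigma> N C F"
  "Is_o_name y \<notin> eq_facts \<Sigma> N C F"
  "Is_i_name c \<notin> eq_facts \<Sigma> N C F"
  "Is_e_name e \<notin> eq_facts \<Sigma> N C F"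
  "Lc a k \<notin> eq_facts \<Sigma> N C F"
  "Lp p a \<notin> eq_facts \<Sigma> N C F"
  "Prnt w z \<in> eq_facts \<Sigma> N C F \<longleftrightarrow>
     (\<exists>x\<in>places F. \<exists>j<sites C. prnt F x = PRoot j \<and>
        w = place_name N x \<and> z = parent_name N (prnt C (Site j)))"
  "Link u t \<in> eq_facts \<Sigma> N C F \<longleftrightarrow>
     (\<exists>x\<in>points \<Sigma> F. \<exists>y\<in>inn C. link F x = Outer y \<and>
        u = point_name N x \<and> t = target_name N (link C (Inner y)))"
  "Has_child_p z n \<notin> eq_facts \<Sigma> N C F"
  "Has_child_l t n \<notin> eq_facts \<Sigma> N C F"
proof -
  note inv_simps = injective_names[OF N, THEN inv_f_f]
  show "Prnt w z \<in> eq_facts \<Sigma> N C F \<longleftrightarrow>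
     (\<exists>x\<in>places F. \<exists>j<sites C. prnt F x = PRoot j \<and>
        w = place_name N x \<and> z = parent_name N (prnt C (Site j)))" (is "?L \<longleftrightarrow> ?R")
  proof
    assume ?L
    then show ?R
      using C F by (auto simp: eq_facts_def name_shapes naming_eq_simps[OF N] inv_simps)
  next
    assume ?R
    then obtain x j where x: "x \<in> places F" "j < sites C" "prnt F x = PRoot j"
        "w = place_name N x" "z = parent_name N (prnt C (Site j))"
      by blast
    moreover have "j < roots F"
      using well_formed_prnt[OF F x(1)] x(3) by simp
    moreover have "Prnt w (PRoot (root_name N j)) \<in> facts \<Sigma> N F"
      using x by (auto intro!: bexI[of _ x])
    moreover have "Prnt (Site (site_name N j)) z \<in> facts \<Sigma> N C"
      using x by (auto intro!: bexI[of _ "Site j"])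
    moreover have "inv (site_name N) (site_name N j) = inv (root_name N) (root_name N j)"
      by (simp add: inv_simps)
    ultimately show ?L
      unfolding eq_facts_def mem_enc[OF C] mem_enc[OF F] mem_facts(1,3) by blast
  qed
  show "Link u t \<in> eq_facts \<Sigma> N C F \<longleftrightarrow>
     (\<exists>x\<in>points \<Sigma> F. \<exists>y\<in>inn C. link F x = Outer y \<and>
        u = point_name N x \<and> t = target_name N (link C (Inner y)))" (is "?L \<longleftrightarrow> ?R")
  proof
    assume ?L
    then show ?R
      using C F by (auto simp: eq_facts_def name_shapes naming_eq_simps[OF N] inv_simps)
  next
    assume ?R
    then obtain x y where x: "x \<in> points \<Sigma> F" "y \<in> inn C" "link F x = Outer y"
        "u = point_name N x" "t = target_name N (link C (Inner y))"
      by blast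
    moreover have "y \<in> outn F"
      using well_formed_link[OF F x(1)] x(3) by simp
    moreover have "Link u (Outer (o_name N y)) \<in> facts \<Sigma> N F"
      using x by (auto intro!: bexI[of _ x])
    moreover have "Link (Inner (i_name N y)) t \<in> facts \<Sigma> N C"
      using x by (auto intro!: bexI[of _ "Inner y"])
    moreover have "inv (i_name N) (i_name N y) = inv (o_name N) (o_name N y)"
      by (simp add: inv_simps)
    ultimately show ?L
      unfolding eq_facts_def mem_enc[OF C] mem_enc[OF F] mem_facts(5,6) by blast
  qed
qed (auto simp: eq_facts_def)

text \<open>
  The children of \<open>z\<close> in \<open>C \<circ> F\<close> if \<open>z\<close> belongs to \<open>C\<close>. The guards make this meaningful also when \<open>F\<close>
  has more roots or outer names than \<open>C\<close> has sites or inner names, as for a factor of \<open>D \<otimes> L\<close>.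
\<close>

definition plugged_places :: "('v, 'e, 'n, 'k) bigraph \<Rightarrow> ('v, 'e, 'n, 'k) bigraph \<Rightarrow>
    ('v, nat) parent \<Rightarrow> ('v, nat) place set" where
  "plugged_places C F z = Node ` {v \<in> nodes C. prnt C (Node v) = z} \<union>
     {x \<in> places F. \<exists>j<sites C. prnt F x = PRoot j \<and> prnt C (Site j) = z}"

definition plugged_points :: "'k signature \<Rightarrow> ('v, 'e, 'n, 'k) bigraph \<Rightarrow>
    ('v, 'e, 'n, 'k) bigraph \<Rightarrow> ('e, 'n) target \<Rightarrow> ('v \<times> nat, 'n) point set" where
  "plugged_points \<Sigma> C F t = Port ` {q \<in> ports \<Sigma> C. link C (Port q) = t} \<union>
     {x \<in> points \<Sigma> F. \<exists>y\<in>inn C. link F x = Outer y \<and> link C (Inner y) = t}"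

text \<open>Identifies the part of \<open>C\<close> that \<open>count_facts\<close> counts with the
  frame; multiplicity one makes the multiset difference a set difference.\<close>

lemma frame_facts_enc:
  "well_formed \<Sigma> C \<Longrightarrow> set_mset (enc \<Sigma> N C - in_part \<Sigma> N C) = frame_facts \<Sigma> N C"
  by (auto simp: enc_def in_part_def frame_facts_def finite_facts count_mset_set'
      in_diff_count split: if_splits)

text \<open>The updated counts are cardinalities of sets of names. Injective naming turns them into
  cardinalities of sets of components, hence comparable with the child counts of a
  composite.\<close>

lemma mem_count_facts:
  assumes C: "well_formed \<Sigma> C" and F: "well_formed \<Sigma> F" and N: "injective_naming N"
  shows
  "Is_root r \<notin> count_facts \<Sigma> N C F"
  "Is_node a \<notin> count_facts \<Sigma> N C F"
  "Is_site s \<notin> count_facts \<Sigma> N C F"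
  "Is_port p \<notin> count_facts \<Sigma> N C F"
  "Is_o_name y \<notin> count_facts \<Sigma> N C F"
  "Is_i_name c \<notin> count_facts \<Sigma> N C F"
  "Is_e_name e \<notin> count_facts \<Sigma> N C F"
  "Lc a k \<notin> count_facts \<Sigma> N C F"
  "Lp p a \<notin> count_facts \<Sigma> N C F"
  "Prnt w z \<notin> count_facts \<Sigma> N C F"
  "Link u t \<notin> count_facts \<Sigma> N C F"
  "Has_child_p z n \<in> count_facts \<Sigma> N C F \<longleftrightarrow>
     (\<exists>s<sites C. z = parent_name N (prnt C (Site s)) \<and>
        n = card (plugged_places C F (prnt C (Site s))))"
  "Has_child_l t n \<in> count_facts \<Sigma> N C F \<longleftrightarrow>
     (\<exists>y\<in>inn C. t = target_name N (link C (Inner y)) \<and>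
        n = card (plugged_points \<Sigma> C F (link C (Inner y))))"
proof -
  let ?M = "frame_facts \<Sigma> N C \<union> eq_facts \<Sigma> N C F"
  \<comment> \<open>Frame facts supply the nodes of \<open>C\<close> below \<open>b\<close>, glueing
    facts the places of \<open>F\<close> whose root is plugged in below \<open>b\<close>.\<close>
  have "{w. Prnt w (parent_name N b) \<in> ?M} = place_name N ` plugged_places C F b" for b
    by (auto simp: mem_frame_facts[OF C N] mem_eq_facts[OF C F N] naming_eq_simps[OF N]
        plugged_places_def image_iff bex_Un)
  then have P: "card {w. Prnt w (parent_name N b) \<in> ?M} = card (plugged_places C F b)" for b
    using injective_names(8)[OF N] by (simp add: card_image inj_on_subset)
  have "{u. Link u (target_name N b) \<in> ?M} = point_name N ` plugged_points \<Sigma> C F b" for b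
    by (auto simp: mem_frame_facts[OF C N] mem_eq_facts[OF C F N] naming_eq_simps[OF N]
        plugged_points_def image_iff bex_Un)
  then have L: "card {u. Link u (target_name N b) \<in> ?M} = card (plugged_points \<Sigma> C F b)" for b
    using injective_names(10)[OF N] by (simp add: card_image inj_on_subset)
  show "Has_child_p z n \<in> count_facts \<Sigma> N C F \<longleftrightarrow>
     (\<exists>s<sites C. z = parent_name N (prnt C (Site s)) \<and>
        n = card (plugged_places C F (prnt C (Site s))))"
    unfolding count_facts_def Let_def frame_facts_enc[OF C] mem_enc[OF C]
    by (auto simp: name_shapes bex_places simp flip: P)
  show "Has_child_l t n \<in> count_facts \<Sigma> N C F \<longleftrightarrow>
     (\<exists>y\<in>inn C. t = target_name N (link C (Inner y)) \<and>
        n = card (plugged_points \<Sigma> C F (link C (Inner y))))"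
    unfolding count_facts_def Let_def frame_facts_enc[OF C] mem_enc[OF C]
    by (auto simp: name_shapes bex_points simp flip: L)
qed (auto simp: count_facts_def Let_def)

text \<open>The types of names may be infinite; finiteness comes from the finitely many components,
  each count being determined by its parent or target.\<close>

lemma finite_eq_count_facts:
  assumes C: "well_formed \<Sigma> C" and F: "well_formed \<Sigma> F" and N: "injective_naming N"
  shows "finite (eq_facts \<Sigma> N C F \<union> count_facts \<Sigma> N C F)"
proof -
  let ?S = "(\<lambda>(x, z). Prnt (place_name N x) (parent_name N z)) ` (places F \<times> parents C) \<union>
    (\<lambda>(x, t). Link (point_name N x) (target_name N t)) ` (points \<Sigma> F \<times> targets C) \<union>
    (\<lambda>z. Has_child_p (parent_name N z) (card (plugged_places C F z))) ` parents C \<union>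
    (\<lambda>t. Has_child_l (target_name N t) (card (plugged_points \<Sigma> C F t))) ` targets C"
  have "f \<in> ?S" if "f \<in> eq_facts \<Sigma> N C F \<union> count_facts \<Sigma> N C F" for f
    using that well_formed_prnt[OF C, of "Site j" for j] well_formed_link[OF C, of "Inner y" for y]
    by (cases f) (auto simp: mem_eq_facts[OF C F N] mem_count_facts[OF C F N] image_iff)
  moreover have "finite ?S"
    by (simp add: finite_components[OF C] finite_components[OF F])
  ultimately show ?thesis
    by (blast intro: finite_subset)
qed
lemma plug_parent_eq:
  "plug_parent C y = z \<longleftrightarrow> (case z of PNode v \<Rightarrow> y = PNode v | PRoot _ \<Rightarrow> False) \<or>
     (\<exists>j. y = PRoot j \<and> prnt C (Site j) = z)"
  by (cases y; cases z) auto

section \<open>The encoding of a composite\<close>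

text \<open>Nodes are disjoint, so a place of \<open>F\<close> gets below a parent in
  \<open>C\<close> only through a root, and nothing of \<open>C\<close> lies below a node of
  \<open>F\<close>.\<close>

lemma children_comp:
  assumes C: "well_formed \<Sigma> C" and F: "well_formed \<Sigma> F" and CF: "composable C F"
  shows "z \<in> parents C \<Longrightarrow>
      {x \<in> places (comp C F). prnt (comp C F) x = z} = plugged_places C F z"
    and "v \<in> nodes F \<Longrightarrow>
      {x \<in> places (comp C F). prnt (comp C F) x = PNode v} = {x \<in> places F. prnt F x = PNode v}"
proof -
  have CF': "sites C = roots F" "\<And>v. v \<in> nodes F \<Longrightarrow> v \<notin> nodes C"
    using CF by (auto simp: composable_def)
  note pF = well_formed_prnt[OF F, of "Node v" for v] well_formed_prnt[OF F, of "Site v" for v]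
  note pC = well_formed_prnt[OF C, of "Node v" for v] well_formed_prnt[OF C, of "Site v" for v]
  { assume z: "z \<in> parents C"
    have "x \<in> places (comp C F) \<and> prnt (comp C F) x = z \<longleftrightarrow> x \<in> plugged_places C F z" for x
      using z pF CF'
      by (cases x; cases z) (force simp: plugged_places_def plug_parent_eq)+
    then show "{x \<in> places (comp C F). prnt (comp C F) x = z} = plugged_places C F z"
      by blast }
  { assume v: "v \<in> nodes F"
    have "x \<in> places (comp C F) \<and> prnt (comp C F) x = PNode v \<longleftrightarrow>
        x \<in> places F \<and> prnt F x = PNode v" for x
      using v pF pC CF' by (cases x) (force simp: plug_parent_eq)+
    then show "{x \<in> places (comp C F). prnt (comp C F) x = PNode v} =
        {x \<in> places F. prnt F x = PNode v}"
      by blast }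
qed

lemma points_comp:
  assumes C: "well_formed \<Sigma> C" and F: "well_formed \<Sigma> F" and CF: "composable C F"
  shows "t \<in> targets C \<Longrightarrow>
      {x \<in> points \<Sigma> (comp C F). link (comp C F) x = t} = plugged_points \<Sigma> C F t"
    and "e \<in> edges F \<Longrightarrow>
      {x \<in> points \<Sigma> (comp C F). link (comp C F) x = Edge e} =
      {x \<in> points \<Sigma> F. link F x = Edge e}"
proof -
  have CF': "inn C = outn F" "\<And>e. e \<in> edges F \<Longrightarrow> e \<notin> edges C"
      "ports \<Sigma> (comp C F) = ports \<Sigma> C \<union> ports \<Sigma> F"
    using CF by (auto simp: composable_def ports_comp)
  have lkF: "link (comp C F) (Port q) = plug_target C (link F (Port q))" if "q \<in> ports \<Sigma> F" for q
    using that by (auto simp: ports_def)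
  have lkC: "link (comp C F) (Port q) = link C (Port q)" if "q \<in> ports \<Sigma> C" for q
    using that CF by (auto simp: ports_def composable_def)
  have excl: "q \<notin> ports \<Sigma> C" if "q \<in> ports \<Sigma> F" for q
    using that CF by (auto simp: ports_def composable_def)
  have pF: "link F (Port q) \<in> targets F" if "q \<in> ports \<Sigma> F" for q
    using well_formed_link[OF F] that by simp
  have pF': "link F (Inner y) \<in> targets F" if "y \<in> inn F" for y
    using well_formed_link[OF F] that by simp
  have notC: "link C x \<noteq> Edge e" if "e \<in> edges F" "x \<in> points \<Sigma> C" for e x
    using well_formed_link[OF C that(2)] CF'(2)[OF that(1)] by auto
  \<comment> \<open>An edge of \<open>F\<close> is no target of \<open>C\<close>, so a link from
    \<open>F\<close> reaches \<open>t\<close> only through an outer name. Dually, in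
    \<open>plugF'\<close>, an edge of \<open>F\<close> is reached only by staying inside
    \<open>F\<close>.\<close>
  have plugF: "plug_target C y = t \<longleftrightarrow> (\<exists>x\<in>inn C. y = Outer x \<and> link C (Inner x) = t)"
    if "y \<in> targets F" "t \<in> targets C" for y t
    using that CF'(1,2) by (cases y) auto
  have plugF': "plug_target C y = Edge e \<longleftrightarrow> y = Edge e" if "y \<in> targets F" "e \<in> edges F" for y e
    using that CF'(1) notC by (cases y) auto
  { assume t: "t \<in> targets C"
    have "x \<in> points \<Sigma> (comp C F) \<and> link (comp C F) x = t \<longleftrightarrow> x \<in> plugged_points \<Sigma> C F t" for x
    proof (cases x)
      case (Port q)
      show ?thesis
        using plugF[OF pF t, of q] excl[of q]
        by (cases "q \<in> ports \<Sigma> F")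
          (auto simp: Port plugged_points_def CF'(3) lkF lkC simp del: comp_maps)
    next
      case (Inner y)
      show ?thesis
        using plugF[OF pF' t, of y] by (auto simp: Inner plugged_points_def)
    qed
    then show "{x \<in> points \<Sigma> (comp C F). link (comp C F) x = t} = plugged_points \<Sigma> C F t"
      by blast }
  { assume e: "e \<in> edges F"
    have "x \<in> points \<Sigma> (comp C F) \<and> link (comp C F) x = Edge e \<longleftrightarrow>
        x \<in> points \<Sigma> F \<and> link F x = Edge e" for x
    proof (cases x)
      case (Port q)
      show ?thesis
        unfolding Port using e
        by (auto simp: CF'(3) lkF lkC plugF' pF notC simp del: comp_maps)
    next
      case (Inner y)
      show ?thesis
        unfolding Inner using e by (auto simp: plugF' pF')
    qed
    then show "{x \<in> points \<Sigma> (comp C F). link (comp C F) x = Edge e} =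
        {x \<in> points \<Sigma> F. link F x = Edge e}"
      by blast }
qed

text \<open>Where no site or inner name is attached, plugging adds nothing, so counts kept in the
  frame remain correct in the composite.\<close>

lemma plugged_unplugged:
  "\<forall>s<sites C. prnt C (Site s) \<noteq> z \<Longrightarrow> plugged_places C F z = {x \<in> places C. prnt C x = z}"
  "\<forall>y\<in>inn C. link C (Inner y) \<noteq> t \<Longrightarrow>
     plugged_points \<Sigma> C F t = {x \<in> points \<Sigma> C. link C x = t}"
  by (auto simp: plugged_places_def plugged_points_def places_def points_def)

text \<open>As \<open>F\<close> is ground, each of its facts is interior or on its outer face. The
  latter vanish: their parent and link facts are redirected by the glueing, and the counts at
  \<open>C\<close> are updated. Disjointness of the two parts later turns the union into a multiset
  sum with \<open>\<Delta>\<close>.\<close>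

lemma facts_comp:
  assumes C: "well_formed \<Sigma> C" and F: "well_formed \<Sigma> F" and CF: "composable C F"
    and g: "ground F" and N: "injective_naming N"
  shows "facts \<Sigma> N (comp C F) =
      frame_facts \<Sigma> N C \<union> (core_facts \<Sigma> N F \<union> eq_facts \<Sigma> N C F \<union> count_facts \<Sigma> N C F)"
    and "frame_facts \<Sigma> N C \<inter>
      (core_facts \<Sigma> N F \<union> eq_facts \<Sigma> N C F \<union> count_facts \<Sigma> N C F) = {}"
proof -
  have F0 [simp]: "sites F = 0" "inn F = {}"
    using g by (simp_all add: ground_def)
  have CF': "sites C = roots F" "inn C = outn F"
      "\<And>v. v \<in> nodes F \<Longrightarrow> v \<notin> nodes C" "\<And>e. e \<in> edges F \<Longrightarrow> e \<notin> edges C"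
      "ports \<Sigma> (comp C F) = ports \<Sigma> C \<union> ports \<Sigma> F"
      "\<And>p. p \<in> ports \<Sigma> F \<Longrightarrow> fst p \<in> nodes F" "\<And>p. p \<in> ports \<Sigma> C \<Longrightarrow> fst p \<in> nodes C"
    using CF ports_comp[of C F \<Sigma>] by (auto simp: composable_def ports_def[of \<Sigma> C] ports_def[of \<Sigma> F])
  have notF: "v \<notin> nodes F" if "v \<in> nodes C" for v
    using CF'(3) that by blast
  note mems = mem_frame_facts[OF C N] mem_core_facts[OF F N] mem_eq_facts[OF C F N]
    mem_count_facts[OF C F N]
  note wf = well_formed_prnt[OF F, of "Node v" for v] well_formed_link[OF F, of "Port p" for p]
    well_formed_prnt[OF C, of "Site v" for v] well_formed_link[OF C, of "Inner y" for y]
  let ?R = "frame_facts \<Sigma> N C \<union>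
    (core_facts \<Sigma> N F \<union> eq_facts \<Sigma> N C F \<union> count_facts \<Sigma> N C F)"
  have pC: "Prnt (Node (node_name N v)) (parent_name N (prnt C (Node v))) \<in> ?R"
    if "v \<in> nodes C" for v
    using that by (auto simp: mem_frame_facts[OF C N])
  have lC: "Link (Port (port_name N q)) (target_name N (link C (Port q))) \<in> ?R"
    if "q \<in> ports \<Sigma> C" for q
    using that by (auto simp: mem_frame_facts[OF C N])
  have pF: "Prnt (Node (node_name N v)) (parent_name N (plug_parent C (prnt F (Node v)))) \<in> ?R"
    if "v \<in> nodes F" for v
    using wf(1)[of v] that CF'(1)
    by (cases "prnt F (Node v)") (auto simp: mems bex_places naming_eq_simps[OF N])
  have lF: "Link (Port (port_name N q)) (target_name N (plug_target C (link F (Port q)))) \<in> ?R"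
    if "q \<in> ports \<Sigma> F" for q
    using wf(2)[of q] that CF'(2)
    by (cases "link F (Port q)") (auto simp: mems bex_points naming_eq_simps[OF N])
  \<comment> \<open>A count at a parent in \<open>C\<close> is an updated one if a site is attached
    there and a frame fact otherwise; a count at a node of \<open>F\<close> is interior to
    \<open>F\<close>. Likewise for links in \<open>card_l\<close>.\<close>
  have card_p: "Has_child_p (parent_name N z)
      (card {x \<in> places (comp C F). prnt (comp C F) x = z}) \<in> ?R" if z: "z \<in> parents (comp C F)" for z
  proof (cases "z \<in> parents C")
    case True
    then show ?thesis
      using CF' by (cases "\<exists>s<sites C. prnt C (Site s) = z")
        (auto simp: children_comp[OF C F CF] mems naming_eq_simps[OF N] plugged_unplugged)
  next
    case False
    then obtain v where "z = PNode v" "v \<in> nodes F"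
      using z by (cases z) auto
    then show ?thesis
      by (auto simp: children_comp[OF C F CF] mems naming_eq_simps[OF N])
  qed
  have card_l: "Has_child_l (target_name N t)
      (card {x \<in> points \<Sigma> (comp C F). link (comp C F) x = t}) \<in> ?R"
    if t: "t \<in> targets (comp C F)" for t
  proof (cases "t \<in> targets C")
    case True
    then show ?thesis
      using CF' by (cases "\<exists>y\<in>inn C. link C (Inner y) = t")
        (auto simp: points_comp[OF C F CF] mems naming_eq_simps[OF N] plugged_unplugged)
  next
    case False
    then obtain e where "t = Edge e" "e \<in> edges F"
      using t by (cases t) auto
    then show ?thesis
      by (auto simp: points_comp[OF C F CF] mems naming_eq_simps[OF N])
  qed
  show "facts \<Sigma> N (comp C F) = ?R"
  proof (rule set_eqI, rule iffI)
    fix f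
    assume "f \<in> facts \<Sigma> N (comp C F)"
    then show "f \<in> ?R"
    proof (cases f)
      case (Prnt w z)
      with \<open>f \<in> facts \<Sigma> N (comp C F)\<close> obtain v where v: "v \<in> nodes C \<or> v \<in> nodes F"
          "f = Prnt (Node (node_name N v)) (parent_name N (prnt (comp C F) (Node v)))"
        by (auto simp: bex_places simp del: comp_maps)
      then show ?thesis
        using pF[of v] pC[of v] by (cases "v \<in> nodes F") simp_all
    next
      case (Link u t)
      with \<open>f \<in> facts \<Sigma> N (comp C F)\<close> obtain q where q: "q \<in> ports \<Sigma> C \<or> q \<in> ports \<Sigma> F"
          "f = Link (Port (port_name N q)) (target_name N (link (comp C F) (Port q)))"
        by (auto simp: bex_points CF'(5) simp del: comp_maps)
      then show ?thesis
        using lF[of q] lC[of q] CF'(6,7)[of q] notF[of "fst q"]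
        by (cases "q \<in> ports \<Sigma> F") simp_all
    next
      case (Has_child_p z n)
      with \<open>f \<in> facts \<Sigma> N (comp C F)\<close> show ?thesis
        using card_p by auto
    next
      case (Has_child_l t n)
      with \<open>f \<in> facts \<Sigma> N (comp C F)\<close> show ?thesis
        using card_l by auto
    qed (use CF' notF in \<open>auto simp: mems\<close>)
  next
    fix f
    assume f: "f \<in> ?R"
    have sub: "z \<in> parents (comp C F)" if "z \<in> parents C" for z
      using that by (cases z) auto
    have sub': "t \<in> targets (comp C F)" if "t \<in> targets C" for t
      using that by (cases t) auto
    show "f \<in> facts \<Sigma> N (comp C F)"
    proof (cases f)
      case (Prnt w z)
      with f show ?thesis
        using notF by (auto simp: mems bex_places)
    next
      case (Link u t)
      with f show ?thesis
        using notF CF' by (fastforce simp: mems bex_points)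
    next
      case (Has_child_p z n)
      have "\<exists>b\<in>parents (comp C F). z = parent_name N b \<and>
          n = card {x \<in> places (comp C F). prnt (comp C F) x = b}"
      proof -
        \<comment> \<open>Frame counts and updated counts of \<open>C\<close> both take the form of
          case \<open>a\<close>, by \<open>plugged_unplugged\<close>; case \<open>b\<close> is
          interior to \<open>F\<close>.\<close>
        consider (a) b where "b \<in> parents C" "z = parent_name N b" "n = card (plugged_places C F b)"
          | (b) v where "v \<in> nodes F" "z = PNode (node_name N v)"
              "n = card {x \<in> places F. prnt F x = PNode v}"
          using f wf(3) by (auto simp: Has_child_p mems plugged_unplugged)
        then show ?thesis
        proof cases
          case a
          then show ?thesis
            using sub by (auto simp: children_comp[OF C F CF] intro!: bexI[of _ b])
        next
          case (b v)
          then show ?thesis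
            by (auto simp: children_comp[OF C F CF] intro!: bexI[of _ "PNode v"])
        qed
      qed
      then show ?thesis
        by (simp add: Has_child_p)
    next
      case (Has_child_l t n)
      have "\<exists>b\<in>targets (comp C F). t = target_name N b \<and>
          n = card {x \<in> points \<Sigma> (comp C F). link (comp C F) x = b}"
      proof -
        consider (a) b where "b \<in> targets C" "t = target_name N b"
              "n = card (plugged_points \<Sigma> C F b)"
          | (b) e where "e \<in> edges F" "t = Edge (e_name N e)"
              "n = card {x \<in> points \<Sigma> F. link F x = Edge e}"
          using f wf(4) by (auto simp: Has_child_l mems plugged_unplugged)
        then show ?thesis
        proof cases
          case a
          then show ?thesis
            using sub' by (auto simp: points_comp[OF C F CF] intro!: bexI[of _ b])
        next
          case (b e)
          then show ?thesis
            by (auto simp: points_comp[OF C F CF] intro!: bexI[of _ "Edge e"])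
        qed
      qed
      then show ?thesis
        by (simp add: Has_child_l)
    qed (use f CF' notF in \<open>auto simp: mems\<close>)
  qed
  \<comment> \<open>Sources of \<open>Prnt\<close> and \<open>Link\<close> facts lie in
    \<open>C\<close> for the frame and in \<open>F\<close> for the other part. Counts at
    \<open>C\<close> are told apart by whether a site or inner name is attached.\<close>
  have "f \<notin> core_facts \<Sigma> N F \<union> eq_facts \<Sigma> N C F \<union> count_facts \<Sigma> N C F"
    if f: "f \<in> frame_facts \<Sigma> N C" for f
    using f CF' by (cases f) (auto simp: mems naming_eq_simps[OF N] name_shapes bex_places bex_points
        eq_commute[of "parent_name N b" "PNode a" for a b]
        eq_commute[of "target_name N b" "Edge a" for a b])
  then show "frame_facts \<Sigma> N C \<inter>
      (core_facts \<Sigma> N F \<union> eq_facts \<Sigma> N C F \<union> count_facts \<Sigma> N C F) = {}"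
    by blast
qed

section \<open>Interiors of ground bigraphs and of composites\<close>

lemma facts_not_inner:
  assumes "ground B" and "well_formed \<Sigma> B" and "f \<in> facts \<Sigma> N B"
  shows "\<not> on_inner (enc \<Sigma> N B) f"
proof -
  have "Prnt (Site s) z \<notin> facts \<Sigma> N B" "Link (Inner c) t \<notin> facts \<Sigma> N B" for s z c t
    using assms(1) by (auto simp: ground_def bex_places bex_points)
  then show ?thesis
    using assms
    by (cases "(enc \<Sigma> N B, f)" rule: on_inner.cases) (auto simp: ground_def name_shapes)
qed

lemma core_facts_ground:
  assumes "ground B" and "well_formed \<Sigma> B"
  shows "core_facts \<Sigma> N B = {f \<in> facts \<Sigma> N B. \<not> on_outer f}"
  using facts_not_inner[OF assms] by (auto simp: core_facts_def)

text \<open>The set behind \<open>eq_part\<close>, left unfiltered so that it serves the outermost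
  glueing as well as the inner ones.\<close>

definition join_facts where
  "join_facts \<Sigma> N C F = eq_facts \<Sigma> N C F \<union> count_facts \<Sigma> N C F"

text \<open>With \<open>F\<close> the composite is ground too, so its interior is everything off its
  outer face. Filtering the decomposition of its facts cuts the frame of \<open>C\<close> down to
  the interior of \<open>C\<close> and keeps all of the interior of \<open>F\<close>.\<close>

lemma core_facts_comp:
  assumes C: "well_formed \<Sigma> C" and F: "well_formed \<Sigma> F" and CF: "composable C F"
    and g: "ground F" and N: "injective_naming N"
  shows "core_facts \<Sigma> N (comp C F) =
    core_facts \<Sigma> N C \<union> core_facts \<Sigma> N F \<union> {f \<in> join_facts \<Sigma> N C F. \<not> on_outer f}"
proof -
  have "ground (comp C F)"
    using g by (simp add: ground_def)
  then have "core_facts \<Sigma> N (comp C F) = {f \<in> facts \<Sigma> N (comp C F). \<not> on_outer f}"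
    using well_formed_comp[OF C F CF] by (rule core_facts_ground)
  then show ?thesis
    unfolding facts_comp(1)[OF C F CF g N] join_facts_def
    by (auto simp: core_facts_eq)
qed

section \<open>The encoding of a juxtaposition\<close>

lemma map_parent_eq_PNode [simp]: "map_parent id f z = PNode v \<longleftrightarrow> z = PNode v"
  by (cases z) auto

text \<open>In \<open>juxt D L\<close> the factor \<open>L\<close> keeps its numbering. As
  \<open>D\<close> has no sites and \<open>L\<close> no inner names, all sites come from
  \<open>L\<close> with unchanged indices and all inner names from \<open>D\<close>.\<close>

context
  fixes \<Sigma> :: "'k signature" and D L :: "('v, 'e, 'n, 'k) bigraph"
  assumes D: "well_formed \<Sigma> D" and L: "well_formed \<Sigma> L" and DL: "juxtaposable D L"
    and D0 [simp]: "sites D = 0" and L0 [simp]: "inn L = {}"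
begin

lemma juxt_disjoint:
  "v \<in> nodes D \<Longrightarrow> v \<notin> nodes L" "e \<in> edges D \<Longrightarrow> e \<notin> edges L"
  "v \<in> nodes L \<Longrightarrow> v \<notin> nodes D" "e \<in> edges L \<Longrightarrow> e \<notin> edges D"
  using DL by (auto simp: juxtaposable_def)

lemma ports_juxt': "ports \<Sigma> (juxt D L) = ports \<Sigma> D \<union> ports \<Sigma> L"
  using DL by (simp add: ports_juxt juxtaposable_def)

lemma link_juxt:
  "q \<in> ports \<Sigma> D \<Longrightarrow> link (juxt D L) (Port q) = link D (Port q)"
  "q \<in> ports \<Sigma> L \<Longrightarrow> link (juxt D L) (Port q) = link L (Port q)"
  "link (juxt D L) (Inner y) = link D (Inner y)"
  using juxt_disjoint(1) by (auto simp: ports_def)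

lemma juxt_targets:
  "e \<in> edges L \<Longrightarrow> x \<in> points \<Sigma> D \<Longrightarrow> link D x \<noteq> Edge e"
  "e \<in> edges D \<Longrightarrow> x \<in> points \<Sigma> L \<Longrightarrow> link L x \<noteq> Edge e"
  "v \<in> nodes L \<Longrightarrow> w \<in> places D \<Longrightarrow> prnt D w \<noteq> PNode v"
  "v \<in> nodes D \<Longrightarrow> w \<in> places L \<Longrightarrow> prnt L w \<noteq> PNode v"
  using well_formed_link[OF D] well_formed_link[OF L] well_formed_prnt[OF D] well_formed_prnt[OF L]
    juxt_disjoint by fastforce+

text \<open>Only nodes are considered as parents: the roots of \<open>D\<close> are shifted in the
  product, and counts at roots belong to the outer face.\<close>

lemma children_juxt:
  "v \<in> nodes L \<Longrightarrow>
     {x \<in> places (juxt D L). prnt (juxt D L) x = PNode v} = {x \<in> places L. prnt L x = PNode v}"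
  "v \<in> nodes D \<Longrightarrow>
     {x \<in> places (juxt D L). prnt (juxt D L) x = PNode v} = {x \<in> places D. prnt D x = PNode v}"
proof -
  { assume v: "v \<in> nodes L"
    have "x \<in> places (juxt D L) \<and> prnt (juxt D L) x = PNode v \<longleftrightarrow>
        x \<in> places L \<and> prnt L x = PNode v" for x
      using juxt_targets(3)[OF v, of x] by (cases x) auto
    then show "{x \<in> places (juxt D L). prnt (juxt D L) x = PNode v} =
        {x \<in> places L. prnt L x = PNode v}"
      by blast }
  { assume v: "v \<in> nodes D"
    have "x \<in> places (juxt D L) \<and> prnt (juxt D L) x = PNode v \<longleftrightarrow>
        x \<in> places D \<and> prnt D x = PNode v" for x
      using juxt_targets(4)[OF v, of x] by (cases x) (auto simp: juxt_disjoint(1))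
    then show "{x \<in> places (juxt D L). prnt (juxt D L) x = PNode v} =
        {x \<in> places D. prnt D x = PNode v}"
      by blast }
qed

lemma points_juxt:
  "e \<in> edges L \<Longrightarrow> {x \<in> points \<Sigma> (juxt D L). link (juxt D L) x = Edge e} =
     {x \<in> points \<Sigma> L. link L x = Edge e}"
  "e \<in> edges D \<Longrightarrow> {x \<in> points \<Sigma> (juxt D L). link (juxt D L) x = Edge e} =
     {x \<in> points \<Sigma> D. link D x = Edge e}"
proof -
  { assume e: "e \<in> edges L"
    have "x \<in> points \<Sigma> (juxt D L) \<and> link (juxt D L) x = Edge e \<longleftrightarrow>
        x \<in> points \<Sigma> L \<and> link L x = Edge e" for x
      using juxt_targets(1)[OF e, of x]
      by (cases x) (auto simp: ports_juxt' link_juxt simp del: juxt_maps)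
    then show "{x \<in> points \<Sigma> (juxt D L). link (juxt D L) x = Edge e} =
        {x \<in> points \<Sigma> L. link L x = Edge e}"
      by blast }
  { assume e: "e \<in> edges D"
    have "x \<in> points \<Sigma> (juxt D L) \<and> link (juxt D L) x = Edge e \<longleftrightarrow>
        x \<in> points \<Sigma> D \<and> link D x = Edge e" for x
      using juxt_targets(2)[OF e, of x]
      by (cases x) (auto simp: ports_juxt' link_juxt simp del: juxt_maps)
    then show "{x \<in> points \<Sigma> (juxt D L). link (juxt D L) x = Edge e} =
        {x \<in> points \<Sigma> D. link D x = Edge e}"
      by blast }
qed

text \<open>The asymmetry reflects where glueing happens: with sites only in \<open>L\<close> and
  inner names only in \<open>D\<close>, the nodes and edges receiving updated counts are nodes of
  \<open>L\<close> and edges of \<open>D\<close>.\<close>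

lemma plugged_juxt:
  "v \<in> nodes L \<Longrightarrow> plugged_places (juxt D L) F (PNode v) = plugged_places L F (PNode v)"
  "e \<in> edges D \<Longrightarrow> plugged_points \<Sigma> (juxt D L) F (Edge e) = plugged_points \<Sigma> D F (Edge e)"
proof -
  { assume v: "v \<in> nodes L"
    have "{u \<in> nodes (juxt D L). prnt (juxt D L) (Node u) = PNode v} =
        {u \<in> nodes L. prnt L (Node u) = PNode v}"
      using juxt_targets(3)[OF v, of "Node u" for u] by auto
    then show "plugged_places (juxt D L) F (PNode v) = plugged_places L F (PNode v)"
      unfolding plugged_places_def by auto }
  { assume e: "e \<in> edges D"
    have "{q \<in> ports \<Sigma> (juxt D L). link (juxt D L) (Port q) = Edge e} =
        {q \<in> ports \<Sigma> D. link D (Port q) = Edge e}"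
      using juxt_targets(2)[OF e, of "Port q" for q]
      by (auto simp: ports_juxt' link_juxt simp del: juxt_maps)
    then show "plugged_points \<Sigma> (juxt D L) F (Edge e) = plugged_points \<Sigma> D F (Edge e)"
      unfolding plugged_points_def by (simp add: link_juxt del: juxt_maps) }
qed

context
  fixes N :: "('v, 'e, 'n, 'a, 'r, 's, 'p, 'o, 'i, 'd) naming"
  assumes N: "injective_naming N"
begin

lemma core_facts_juxt: "core_facts \<Sigma> N (juxt D L) = core_facts \<Sigma> N D \<union> core_facts \<Sigma> N L"
proof -
  have J: "well_formed \<Sigma> (juxt D L)"
    using D L DL by (simp add: well_formed_juxt juxtaposable_def)
  note mems = mem_core_facts[OF J N] mem_core_facts[OF D N] mem_core_facts[OF L N]
  \<comment> \<open>The sites of the product are those of \<open>L\<close>, none of which lies below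
    a node of \<open>D\<close>, so the condition on sites holds at such a node in the product as it
    does in \<open>D\<close>. Dually for inner names and edges of \<open>L\<close>.\<close>
  have P: "(\<forall>s<sites L. prnt L (Site s) \<noteq> PNode v)" if "v \<in> nodes D" for v
    using juxt_targets(4)[OF that] by simp
  have I: "(\<forall>x\<in>inn D. link D (Inner x) \<noteq> Edge e)" if "e \<in> edges L" for e
    using juxt_targets(1)[OF that] by simp
  have "f \<in> core_facts \<Sigma> N (juxt D L) \<longleftrightarrow> f \<in> core_facts \<Sigma> N D \<or> f \<in> core_facts \<Sigma> N L" for f
  proof (cases f)
    case (Prnt w z)
    then show ?thesis
      using juxt_disjoint(1) by (auto simp: mems bex_Un)
  next
    case (Link u t)
    then show ?thesis
      by (simp add: mems bex_Un ports_juxt' link_juxt disj_commute cong: bex_cong del: juxt_maps)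
  next
    case (Has_child_p z n)
    then show ?thesis
      by (simp add: mems bex_Un children_juxt P disj_commute cong: bex_cong)
  next
    case (Has_child_l t n)
    then show ?thesis
      by (simp add: mems bex_Un points_juxt I disj_commute cong: bex_cong)
  qed (use juxt_disjoint(1) in \<open>auto simp: mems ports_juxt' bex_Un\<close>)
  then show ?thesis
    by blast
qed

text \<open>Parent facts are glued only at \<open>L\<close> and link facts of the outer bigraph only
  at \<open>D\<close>. Off the outer face, counts sit at nodes and edges, where
  \<open>plugged_juxt\<close> compares them.\<close>

lemma join_facts_juxt:
  assumes F: "well_formed \<Sigma> F"
  shows "{f \<in> join_facts \<Sigma> N (juxt D L) F. \<not> on_outer f} =
    {f \<in> join_facts \<Sigma> N D F. \<not> on_outer f} \<union> {f \<in> join_facts \<Sigma> N L F. \<not> on_outer f}"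
proof -
  have J: "well_formed \<Sigma> (juxt D L)"
    using D L DL by (simp add: well_formed_juxt juxtaposable_def)
  note mems = mem_eq_facts[OF J F N] mem_eq_facts[OF D F N] mem_eq_facts[OF L F N]
    mem_count_facts[OF J F N] mem_count_facts[OF D F N] mem_count_facts[OF L F N]
  have P: "v \<in> nodes L" if "s < sites L" "prnt L (Site s) = PNode v" for s v
    using well_formed_prnt[OF L, of "Site s"] that by simp
  have I: "e \<in> edges D" if "y \<in> inn D" "link D (Inner y) = Edge e" for y e
    using well_formed_link[OF D, of "Inner y"] that by simp
  have "f \<in> join_facts \<Sigma> N (juxt D L) F \<longleftrightarrow> f \<in> join_facts \<Sigma> N D F \<or> f \<in> join_facts \<Sigma> N L F"
    if o: "\<not> on_outer f" for f
  proof (cases f)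
    case (Has_child_p z n)
    have "plugged_places (juxt D L) F (prnt L (Site s)) = plugged_places L F (prnt L (Site s))"
      if "s < sites L" "z = parent_name N (prnt L (Site s))" for s
      using o that P[OF that(1)] by (auto simp: Has_child_p plugged_juxt)
    then show ?thesis
      by (simp add: Has_child_p join_facts_def mems cong: conj_cong)
  next
    case (Has_child_l t n)
    have "plugged_points \<Sigma> (juxt D L) F (link D (Inner y)) = plugged_points \<Sigma> D F (link D (Inner y))"
      if "y \<in> inn D" "t = target_name N (link D (Inner y))" for y
      using o that I[OF that(1)] by (auto simp: Has_child_l plugged_juxt)
    then show ?thesis
      by (simp add: Has_child_l join_facts_def mems cong: conj_cong)
  qed (auto simp: join_facts_def mems)
  then show ?thesis
    by blast
qed

end

end

section \<open>Renaming and the main result\<close>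

text \<open>\<open>via\<close> names a component of \<open>B\<close> by the name of its image in
  \<open>G\<close>. The main point is the counts: the bijections commute with the maps and so match
  up preimages.\<close>

lemma facts_via:
  fixes B G :: "('v, 'e, 'n, 'k) bigraph"
  assumes B: "well_formed \<Sigma> B" and iso: "lean_iso \<Sigma> (fst \<rho>) (snd \<rho>) B G"
  shows "facts \<Sigma> (via \<rho> N) B = facts \<Sigma> N G"
proof -
  let ?pl = "map_place (fst \<rho>) id :: ('v, nat) place \<Rightarrow> _"
  let ?pr = "map_parent (fst \<rho>) id :: ('v, nat) parent \<Rightarrow> _"
  let ?pt = "map_point (apfst (fst \<rho>)) id :: ('v \<times> nat, 'n) point \<Rightarrow> _"
  let ?tg = "map_target (snd \<rho>) id :: ('e, 'n) target \<Rightarrow> _"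
  have same: "sites G = sites B" "inn G = inn B" "roots G = roots B" "outn G = outn B"
    and V: "inj_on (fst \<rho>) (nodes B)" "nodes G = fst \<rho> ` nodes B"
    and E: "inj_on (snd \<rho>) (edges B)" "edges G = snd \<rho> ` edges B"
    and ctrl: "\<And>v. v \<in> nodes B \<Longrightarrow> ctrl G (fst \<rho> v) = ctrl B v"
    and prnt: "\<And>x. x \<in> places B \<Longrightarrow> prnt G (?pl x) = ?pr (prnt B x)"
    and link: "\<And>x. x \<in> points \<Sigma> B \<Longrightarrow> link G (?pt x) = ?tg (link B x)"
    using iso by (auto simp: lean_iso_def same_inner_def same_outer_def bij_betw_def)
  \<comment> \<open>Preserved controls give corresponding nodes the same arity.\<close>
  have ports: "ports \<Sigma> G = apfst (fst \<rho>) ` ports \<Sigma> B"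
    using ctrl by (force simp: ports_def V(2) image_iff apfst_def)
  have pt: "points \<Sigma> G = ?pt ` points \<Sigma> B"
    by (simp add: points_def same ports image_Un image_image)
  have pt_inj: "inj_on ?pt (points \<Sigma> B)"
  proof (rule inj_onI)
    fix x y
    assume "x \<in> points \<Sigma> B" "y \<in> points \<Sigma> B" "?pt x = ?pt y"
    then show "x = y"
      using inj_onD[OF V(1)] by (cases x; cases y) (auto simp: ports_def)
  qed
  have pl: "places G = ?pl ` places B"
    by (simp add: places_def same V(2) image_Un image_image)
  have pl_inj: "inj_on ?pl (places B)"
  proof (rule inj_onI)
    fix x y
    assume "x \<in> places B" "y \<in> places B" "?pl x = ?pl y"
    then show "x = y"
      using inj_onD[OF V(1)] by (cases x; cases y) auto
  qed
  have pr: "parents G = ?pr ` parents B"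
    by (simp add: parents_def same V(2) image_Un image_image)
  have pr_inj: "inj_on ?pr (parents B)"
  proof (rule inj_onI)
    fix x y
    assume "x \<in> parents B" "y \<in> parents B" "?pr x = ?pr y"
    then show "x = y"
      using inj_onD[OF V(1)] by (cases x; cases y) auto
  qed
  have tg: "targets G = ?tg ` targets B"
    by (simp add: targets_def same E(2) image_Un image_image)
  have tg_inj: "inj_on ?tg (targets B)"
  proof (rule inj_onI)
    fix x y
    assume "x \<in> targets B" "y \<in> targets B" "?tg x = ?tg y"
    then show "x = y"
      using inj_onD[OF E(1)] by (cases x; cases y) auto
  qed
  have names: "place_name (via \<rho> N) x = place_name N (?pl x)"
      "parent_name (via \<rho> N) z = parent_name N (?pr z)"
      "point_name (via \<rho> N) u = point_name N (?pt u)"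
      "target_name (via \<rho> N) t = target_name N (?tg t)" for x z u t
    by (simp_all add: via_def place.map_comp parent.map_comp point.map_comp target.map_comp)
  have sel: "node_name (via \<rho> N) v = node_name N (fst \<rho> v)" "root_name (via \<rho> N) = root_name N"
      "site_name (via \<rho> N) = site_name N" "port_name (via \<rho> N) q = port_name N (apfst (fst \<rho>) q)"
      "o_name (via \<rho> N) = o_name N" "i_name (via \<rho> N) = i_name N"
      "e_name (via \<rho> N) e = e_name N (snd \<rho> e)" for v q e
    by (simp_all add: via_def)
  have cp: "card {x \<in> places G. prnt G x = ?pr z} = card {x \<in> places B. prnt B x = z}"
    if z: "z \<in> parents B" for z
  proof -
    \<comment> \<open>The renaming is injective only on the components of \<open>B\<close>;
      well-formedness places \<open>prnt B x\<close> among them.\<close>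
    have "?pr (prnt B x) = ?pr z \<longleftrightarrow> prnt B x = z" if "x \<in> places B" for x
      using inj_on_eq_iff[OF pr_inj well_formed_prnt[OF B that] z] .
    then have "{x \<in> places G. prnt G x = ?pr z} = ?pl ` {x \<in> places B. prnt B x = z}"
      unfolding pl by (auto simp: prnt)
    moreover have "inj_on ?pl {x \<in> places B. prnt B x = z}"
      using pl_inj by (rule inj_on_subset) auto
    ultimately show ?thesis
      by (simp add: card_image)
  qed
  have cl: "card {x \<in> points \<Sigma> G. link G x = ?tg t} = card {x \<in> points \<Sigma> B. link B x = t}"
    if t: "t \<in> targets B" for t
  proof -
    have "?tg (link B x) = ?tg t \<longleftrightarrow> link B x = t" if "x \<in> points \<Sigma> B" for x
      using inj_on_eq_iff[OF tg_inj well_formed_link[OF B that] t] .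
    then have "{x \<in> points \<Sigma> G. link G x = ?tg t} = ?pt ` {x \<in> points \<Sigma> B. link B x = t}"
      unfolding pt by (auto simp: link)
    moreover have "inj_on ?pt {x \<in> points \<Sigma> B. link B x = t}"
      using pt_inj by (rule inj_on_subset) auto
    ultimately show ?thesis
      by (simp add: card_image)
  qed
  have "f \<in> facts \<Sigma> (via \<rho> N) B \<longleftrightarrow> f \<in> facts \<Sigma> N G" for f
  proof (cases f)
    case (Prnt w z)
    then show ?thesis
      by (simp add: names pl prnt cong: bex_cong)
  next
    case (Link u t)
    then show ?thesis
      by (simp add: names pt link cong: bex_cong)
  next
    case (Has_child_p z n)
    then show ?thesis
      by (simp add: names pr cp cong: bex_cong)
  next
    case (Has_child_l t n)
    then show ?thesis
      by (simp add: names tg cl cong: bex_cong)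
  next
    case (Is_port p)
    then show ?thesis
      by (simp add: sel ports image_image)
  next
    case (Lp p a)
    then show ?thesis
      by (simp add: sel ports)
  next
    case (Lc a k)
    then show ?thesis
      by (simp add: sel V(2) ctrl cong: bex_cong)
  qed (auto simp: sel same V(2) E(2) ports)
  then show ?thesis
    by blast
qed

section \<open>Sides of the rewrite rules as sets of facts\<close>

lemma union_mset_set:
  "finite A \<Longrightarrow> finite B \<Longrightarrow> mset_set A \<union># mset_set B = mset_set (A \<union> B)"
  \<comment> \<open>Multiset union takes maxima, so overlapping pieces contribute each fact only
    once.\<close>
  by (rule multiset_eqI) (auto simp: count_mset_set')

lemma finite_core_facts: "well_formed \<Sigma> B \<Longrightarrow> finite (core_facts \<Sigma> N B)"
  by (simp add: core_facts_def finite_facts)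

lemma finite_join_facts:
  "well_formed \<Sigma> C \<Longrightarrow> well_formed \<Sigma> F \<Longrightarrow> injective_naming N \<Longrightarrow>
     finite (join_facts \<Sigma> N C F)"
  by (simp only: join_facts_def finite_eq_count_facts)

lemma eq_part_eq: "eq_part \<Sigma> N C F = mset_set (join_facts \<Sigma> N C F)"
  by (simp add: eq_part_def join_facts_def)

lemma inner_eq_part_eq:
  assumes "well_formed \<Sigma> C" "well_formed \<Sigma> F" "injective_naming N"
  shows "inner_eq_part \<Sigma> N C F = mset_set {f \<in> join_facts \<Sigma> N C F. \<not> on_outer f}"
  using finite_join_facts[OF assms]
  by (simp add: inner_eq_part_def eq_part_eq filter_mset_mset_set)

lemma ground_side_eq:
  assumes "well_formed \<Sigma> C" "well_formed \<Sigma> F" "injective_naming N"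
  shows "ground_side \<Sigma> N C F = mset_set (core_facts \<Sigma> N F \<union> join_facts \<Sigma> N C F)"
  using assms
  by (simp add: ground_side_def tilde_eq eq_part_eq union_mset_set finite_core_facts
      finite_join_facts)

text \<open>The six pieces regroup as interior and glueing of the inner composite. The inner
  glueings enter without their outer facts, just as the interior of the composite omits them; their
  replacements belong to the glueing with \<open>C\<close>.\<close>

lemma parametric_side_eq:
  assumes C: "well_formed \<Sigma> C" and D: "well_formed \<Sigma> D" and L: "well_formed \<Sigma> L"
    and F: "well_formed \<Sigma> F" and DL: "juxtaposable D L" and D0: "sites D = 0" and L0: "inn L = {}"
    and JF: "composable (juxt D L) F" and g: "ground F" and N: "injective_naming N"
  shows "parametric_side \<Sigma> N C D L F = ground_side \<Sigma> N C (comp (juxt D L) F)"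
proof -
  have J: "well_formed \<Sigma> (juxt D L)"
    using D L DL by (simp add: well_formed_juxt juxtaposable_def)
  have K: "well_formed \<Sigma> (comp (juxt D L) F)"
    using J F JF by (rule well_formed_comp)
  have "core_facts \<Sigma> N (comp (juxt D L) F) =
      core_facts \<Sigma> N D \<union> core_facts \<Sigma> N L \<union> core_facts \<Sigma> N F \<union>
      ({f \<in> join_facts \<Sigma> N D F. \<not> on_outer f} \<union> {f \<in> join_facts \<Sigma> N L F. \<not> on_outer f})"
    by (simp only: core_facts_comp[OF J F JF g N] core_facts_juxt[OF D L DL D0 L0 N]
        join_facts_juxt[OF D L DL D0 L0 N F])
  then have "core_facts \<Sigma> N (comp (juxt D L) F) \<union> join_facts \<Sigma> N C (comp (juxt D L) F) =
      join_facts \<Sigma> N C (comp (juxt D L) F) \<union> core_facts \<Sigma> N L \<union> core_facts \<Sigma> N D \<union>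
      {f \<in> join_facts \<Sigma> N D F. \<not> on_outer f} \<union> {f \<in> join_facts \<Sigma> N L F. \<not> on_outer f} \<union>
      core_facts \<Sigma> N F"
    by blast
  then show ?thesis
    by (simp add: parametric_side_def ground_side_eq[OF C K N] tilde_eq D L F eq_part_eq
        inner_eq_part_eq[OF D F N] inner_eq_part_eq[OF L F N] union_mset_set finite_core_facts
        finite_join_facts C K N)
qed

text \<open>Multisets of disjoint sets add up, so splitting the facts of the composite splits its
  encoding. The second summand depends on \<open>C\<close> alone, hence is the same for redex and
  reactum.\<close>

lemma enc_comp:
  assumes C: "well_formed \<Sigma> C" and F: "well_formed \<Sigma> F" and CF: "composable C F"
    and B: "agent \<Sigma> B" and iso: "lean_iso \<Sigma> (fst \<rho>) (snd \<rho>) B (comp C F)"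
    and N: "injective_naming N"
  shows "enc \<Sigma> (via \<rho> N) B = ground_side \<Sigma> N C F + mset_set (frame_facts \<Sigma> N C)"
proof -
  have "well_formed \<Sigma> B"
    using B by (simp add: agent_def bigraph_well_formed)
  then have "enc \<Sigma> (via \<rho> N) B = mset_set (facts \<Sigma> N (comp C F))"
    using iso by (simp add: enc_def facts_via)
  \<comment> \<open>The isomorphism preserves the inner face, and the inner face of the composite is
    that of \<open>F\<close>.\<close>
  moreover have "ground F"
    using B iso by (simp add: agent_def ground_def lean_iso_def same_inner_def)
  moreover have "finite (frame_facts \<Sigma> N C)"
    using C by (simp add: frame_facts_def finite_facts)
  moreover have "finite (core_facts \<Sigma> N F \<union> join_facts \<Sigma> N C F)"
    using C F N by (simp add: finite_core_facts finite_join_facts)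
  ultimately show ?thesis
    using facts_comp[OF C F CF _ N]
    by (simp add: ground_side_eq[OF C F N] join_facts_def mset_set_Union Un_assoc add.commute)
qed

text \<open>Both kinds of rule plug two bigraphs into one context \<open>C\<close>; in either case
  \<open>\<Delta>\<close> consists of the frame facts of \<open>C\<close>.\<close>

lemma redex_reactum_sides:
  assumes red: "redex_reactum \<Sigma> (L, R, \<eta>) \<delta> G G'"
    and B: "agent \<Sigma> B" "lean_iso \<Sigma> (fst \<rho>) (snd \<rho>) B G"
    and B': "agent \<Sigma> B'" "lean_iso \<Sigma> (fst \<rho>') (snd \<rho>') B' G'"
    and N: "injective_naming N"
    and rule: "corresponding_rule \<Sigma> N (L, R, \<eta>) \<delta> = (W, Z)"
  shows "\<exists>\<Delta>. enc \<Sigma> (via \<rho> N) B = W + \<Delta> \<and> enc \<Sigma> (via \<rho>' N) B' = Z + \<Delta>"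
proof (cases \<delta>)
  case (Ground_dec C)
  have wf: "well_formed \<Sigma> C" "well_formed \<Sigma> L" "well_formed \<Sigma> R"
    and cmp: "composable C L" "composable C R" and G: "G = comp C L" "G' = comp C R"
    using red by (auto simp: Ground_dec ground_rule_def bigraph_well_formed)
  have "W = ground_side \<Sigma> N C L" "Z = ground_side \<Sigma> N C R"
    using rule by (auto simp: Ground_dec)
  then show ?thesis
    using enc_comp[OF wf(1,2) cmp(1) B[unfolded G] N] enc_comp[OF wf(1,3) cmp(2) B'[unfolded G] N]
    by blast
next
  case (Param_dec C D C' F')
  have wf: "well_formed \<Sigma> C" "well_formed \<Sigma> D" "well_formed \<Sigma> L" "well_formed \<Sigma> R" "well_formed \<Sigma> C'"
    and inn: "inn L = {}" "inn R = {}"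
    and \<eta>: "dom \<eta> = {..<sites R}" "ran \<eta> \<subseteq> {..<sites L}"
    and inst: "instantiation_of \<Sigma> \<eta> (sites L) (sites R) C' F'"
    and L: "juxtaposable D L" "composable (juxt D L) C'" "composable C (comp (juxt D L) C')"
    and R: "juxtaposable D R" "composable (juxt D R) F'" "composable C (comp (juxt D R) F')"
    and G: "G = comp C (comp (juxt D L) C')" "G' = comp C (comp (juxt D R) F')"
    using red by (simp_all add: Param_dec parametric_rule_def bigraph_well_formed)
  have F': "well_formed \<Sigma> F'"
    using inst \<eta> by (rule instantiation_well_formed)
  \<comment> \<open>The interfaces give \<open>sites L + sites D = roots C'\<close>, which equals
    \<open>sites L\<close>.\<close>
  have D0: "sites D = 0"
    using L(2) instantiation_roots[OF inst] by (simp add: composable_def)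
  \<comment> \<open>The inner face of each whole composite is that of its innermost bigraph, and
    agents have an empty one.\<close>
  have g: "ground C'" "ground F'"
    using B B' by (simp_all add: agent_def ground_def lean_iso_def same_inner_def G)
  have K: "well_formed \<Sigma> (comp (juxt D L) C')" "well_formed \<Sigma> (comp (juxt D R) F')"
    using wf F' L R by (auto intro!: well_formed_comp well_formed_juxt simp: juxtaposable_def)
  have "W = ground_side \<Sigma> N C (comp (juxt D L) C')" "Z = ground_side \<Sigma> N C (comp (juxt D R) F')"
    using rule parametric_side_eq[OF wf(1,2,3,5) L(1) D0 inn(1) L(2) g(1) N]
      parametric_side_eq[OF wf(1,2,4) F' R(1) D0 inn(2) R(2) g(2) N]
    by (auto simp: Param_dec)
  then show ?thesis
    using enc_comp[OF wf(1) K(1) L(3) B[unfolded G] N] enc_comp[OF wf(1) K(2) R(3) B'[unfolded G] N]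
    by blast
qed

theorem theorem3:
  fixes \<Sigma> :: "'k signature"
    and \<R> :: "('v, 'e, 'n, 'k) rule set"
    and L R B B' :: "('v, 'e, 'n, 'k) bigraph"
    and \<eta> :: "nat \<rightharpoonup> nat"
    and \<delta> :: "('v, 'e, 'n, 'k) decomposition"
    and \<rho> \<rho>' :: "('v \<Rightarrow> 'v) \<times> ('e \<Rightarrow> 'e)"
    and N :: "('v, 'e, 'n, 'a, 'r, 's, 'p, 'o, 'i, 'd) naming"
    and W Z :: "('a, 'r, 's, 'p, 'o, 'i, 'd, 'k) fact multiset"
  assumes "agent \<Sigma> B" and "agent \<Sigma> B'"
    and "\<forall>r\<in>\<R>. reaction_rule \<Sigma> r"
    and "(L, R, \<eta>) \<in> \<R>"
    and "can_rewrite \<Sigma> (L, R, \<eta>) \<delta> \<rho> B \<rho>' B'"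
    and "injective_naming N"
    and "corresponding_rule \<Sigma> N (L, R, \<eta>) \<delta> = (W, Z)"
  shows "\<exists>\<Delta>. enc \<Sigma> (via \<rho> N) B = W + \<Delta> \<and> enc \<Sigma> (via \<rho>' N) B' = Z + \<Delta>"
  using assms(1,2,5,6,7) redex_reactum_sides unfolding can_rewrite_def by blast

end
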